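(* Let $\mathcal{O}=\{t_1,\dots,t_\mu\}$ be an order ideal in $\mathbb{T}^n$, let $\mathcal{H}$ be an $(n,\mu)$-admissible Hilbert function which dominates $\mathrm{HF}^a_{\mathcal{O}}$, and let $\mathcal{O}'_1,\dots,\mathcal{O}'_\ell$ be the order ideals in $\mathbb{T}^n$ with affine Hilbert function $\mathcal{H}$. (a) For $i=1,\dots,\ell$, the set $\mathbb{B}^{\mathrm{dfb}}_{\mathcal{O}}(\mathcal{O}'_i)$ is an open subscheme of $\mathbb{B}_{\mathcal{O}}(\overline{\mathcal{H}})$ which is contained in $\mathbb{B}_{\mathcal{O}}(\mathcal{H})$. (b) The subschemes $\mathbb{B}^{\mathrm{dfb}}_{\mathcal{O}}(\mathcal{O}'_1),\dots,\mathbb{B}^{\mathrm{dfb}}_{\mathcal{O}}(\mathcal{O}'_\ell)$ form an open covering of $\mathbb{B}_{\mathcal{O}}(\mathcal{H})$.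
   Context: $K$ is an arbitrary field, $P=K[x_1,\dots,x_n]$, and $\mathbb{T}^n$ is the monoid of terms (power products) in $x_1,\dots,x_n$. An order ideal is a finite set $\mathcal{O}=\{t_1,\dots,t_\mu\}\subset\mathbb{T}^n$ with $\mu\ge 1$ containing every divisor in $\mathbb{T}^n$ of each of its elements; it is always ordered so that $\deg(t_1)\le\cdots\le\deg(t_\mu)$, hence $t_1=1$. Its border is $\partial\mathcal{O}=(x_1\mathcal{O}\cup\cdots\cup x_n\mathcal{O})\setminus\mathcal{O}=\{b_1,\dots,b_\nu\}$, and its affine Hilbert function is $\mathrm{HF}^a_{\mathcal{O}}(i)=\#\{j\mid\deg(t_j)\le i\}$. Let $C=\{c_{ij}\mid 1\le i\le\mu,\ 1\le j\le\nu\}$ be new indeterminates. The $r$-th generic multiplication matrix $\mathcal{A}_r=(a^{(r)}_{ij})\in\mathrm{Mat}_\mu(K[C])$ has $a^{(r)}_{ij}=\delta_{im}$ if $x_rt_j=t_m$ and $a^{(r)}_{ij}=c_{im}$ if $x_rt_j=b_m$. $I(\mathbb{B}_{\mathcal{O}})\subseteq K[C]$ is generated by the entries of all commutators $\mathcal{A}_r\mathcal{A}_s-\mathcal{A}_s\mathcal{A}_r$, and the border basis scheme $\mathbb{B}_{\mathcal{O}}\subseteq\mathrm{Spec}(K[C])$ is the closed subscheme it defines. For a $K$-rational point $\Gamma=(\gamma_{ij})$ of $\mathbb{B}_{\mathcal{O}}$, let $I_\Gamma\subset P$ be generated by $b_j-\sum_i\gamma_{ij}t_i$; $\Gamma$ represents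 the 0-dimensional scheme $\mathbb{X}_\Gamma\subset\mathbb{A}^n_K$ with vanishing ideal $I_\Gamma$, and $R_\Gamma=P/I_\Gamma$. For a 0-dimensional $\mathbb{X}\subset\mathbb{A}^n_K$ with $R_{\mathbb{X}}=P/I_{\mathbb{X}}$, let $F_iR_{\mathbb{X}}$ be the image of the polynomials of degree $\le i$; $\mathrm{HF}^a_{\mathbb{X}}(i)=\mathrm{HF}^a_{R_{\mathbb{X}}}(i)=\dim_K F_iR_{\mathbb{X}}$. An order ideal $\mathcal{O}'$ is a degree filtered $K$-basis of $R_{\mathbb{X}}$ if for every $i\ge 0$ the residue classes of its elements of degree $\le i$ form a $K$-basis of $F_iR_{\mathbb{X}}$. A sequence $(H_i)$ dominates $(H'_i)$ if $H_i\ge H'_i$ for all $i\ge 0$ (strictly, if they moreover differ); $\mathcal{H}$ is $(n,\mu)$-admissible if $\mathcal{H}=\mathrm{HF}^a_{\mathbb{X}}$ for some 0-dimensional $\mathbb{X}\subset\mathbb{A}^n_K$ of length $\mu$. $\mathbb{B}_{\mathcal{O}}(\overline{\mathcal{H}})$ is the closed subscheme of $\mathbb{B}_{\mathcal{O}}$ which is the closure of the set of $K$-rational points $\Gamma$ with $\mathrm{HF}^a_{R_\Gamma}$ dominated by $\mathcal{H}$; $\mathbb{B}_{\mathcal{O}}(\mathcal{H})$ is the complement in it of the closure of the set of those $\Gamma$ with $\mathrm{HF}^a_{R_\Gamma}$ strictly dominated by $\mathcal{H}$. For an order ideal $\mathcal{O}'$ with $\mathrm{HF}^a_{\mathcal{O}'}=\mathcal{H}$,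 $\mathbb{B}^{\mathrm{dfb}}_{\mathcal{O}}(\mathcal{O}')$ is the locus in $\mathbb{B}_{\mathcal{O}}(\mathcal{H})$ whose $K$-rational points represent the schemes $\mathbb{X}$ such that $\mathcal{O}'$ is a degree filtered $K$-basis of $R_{\mathbb{X}}$ (possibly empty); explicitly, $\mathbb{B}^{\mathrm{dfb}}_{\mathcal{O}}(\mathcal{O}')=\mathbb{B}_{\mathcal{O}}(\mathcal{H})\setminus\mathcal{Z}(\det(T'))$, where the columns of $T'\in\mathrm{Mat}_\mu(K[C])$ are the first columns of the matrices $t'(\mathcal{A}_1,\dots,\mathcal{A}_n)$ for $t'\in\mathcal{O}'$ (with $t(\mathcal{A}_1,\dots,\mathcal{A}_n)=\mathcal{A}_1^{\alpha_1}\cdots\mathcal{A}_n^{\alpha_n}$ for $t=x_1^{\alpha_1}\cdots x_n^{\alpha_n}$). Conventions: $K$-rational points are to be read as $L$-rational points over field extensions $L\supseteq K$, e.g. $L=\overline{K}$ (in particular closures are formed using $\overline{K}$-rational points); subschemes and their defining ideals are considered up to radical. *)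

theory Defs
  imports
    "HOL-Analysis.Abstract_Topology"
    "HOL-Library.Poly_Mapping"
    "HOL-Algebra.Embedded_Algebras"
    "HOL-Algebra.Algebraic_Closure_Type"
    "Jordan_Normal_Form.Determinant"
begin

section \<open>Terms and polynomial rings\<close>

text \<open>
  A term (power product) is its exponent vector of type \<open>'v \<Rightarrow>\<^sub>0 nat\<close>. The monoid of terms is
  therefore written additively: the term 1 is \<open>0\<close>, and \<open>s + t\<close> is the product of \<open>s\<close> and \<open>t\<close>.
  All indices start at 0: the indeterminates are $x_0, \ldots, x_{n-1}$.
\<close>

definition tdeg :: "('v \<Rightarrow>\<^sub>0 nat) \<Rightarrow> nat" where
  "tdeg t = (\<Sum>v\<in>Poly_Mapping.keys t. Poly_Mapping.lookup t v)"

definition terms :: "nat \<Rightarrow> (nat \<Rightarrow>\<^sub>0 nat) set" where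
  "terms n = {t. Poly_Mapping.keys t \<subseteq> {..<n}}"

definition xvar :: "'v \<Rightarrow> ('v \<Rightarrow>\<^sub>0 nat)" where
  "xvar v = Poly_Mapping.single v 1"

type_synonym ('v, 'a) mpoly = "('v \<Rightarrow>\<^sub>0 nat) \<Rightarrow>\<^sub>0 'a"

definition monomial :: "'a::zero \<Rightarrow> ('v \<Rightarrow>\<^sub>0 nat) \<Rightarrow> ('v, 'a) mpoly" where
  "monomial a t = Poly_Mapping.single t a"

text \<open>The polynomial ring in the set of indeterminates \<open>V\<close>.\<close>

definition mpoly_ring :: "'v set \<Rightarrow> ('v, 'a::comm_ring_1) mpoly ring" where
  "mpoly_ring V = \<lparr>carrier = {p. \<forall>t\<in>Poly_Mapping.keys p. Poly_Mapping.keys t \<subseteq> V},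
     monoid.mult = (*), one = 1, ring.zero = 0, add = (+)\<rparr>"

lemma cring_mpoly_ring: "cring (mpoly_ring V :: ('v, 'a::comm_ring_1) mpoly ring)"
proof -
  define C where "C = {p :: ('v, 'a) mpoly. \<forall>t\<in>Poly_Mapping.keys p. Poly_Mapping.keys t \<subseteq> V}"
  have mult: "p * q \<in> C" if p: "p \<in> C" and q: "q \<in> C" for p q
  proof -
    have "Poly_Mapping.keys t \<subseteq> V" if t: "t \<in> Poly_Mapping.keys (p * q)" for t
    proof -
      obtain a b where "t = a + b" "a \<in> Poly_Mapping.keys p" "b \<in> Poly_Mapping.keys q"
        using subsetD[OF keys_mult t] by blast
      then show ?thesis
        using p q Poly_Mapping.keys_add[of a b] unfolding C_def by blast
    qed
    then show ?thesis unfolding C_def by blast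
  qed
  have add: "p + q \<in> C" if "p \<in> C" "q \<in> C" for p q
    using that Poly_Mapping.keys_add[of p q] unfolding C_def by blast
  have neg: "- p \<in> C" if "p \<in> C" for p
    using that unfolding C_def by (simp add: in_keys_iff)
  have zero: "0 \<in> C" and one: "1 \<in> C"
    unfolding C_def by simp_all
  have sel: "carrier (mpoly_ring V) = C" "monoid.mult (mpoly_ring V) = ((*) :: ('v, 'a) mpoly \<Rightarrow> _)"
    "\<one>\<^bsub>mpoly_ring V\<^esub> = (1 :: ('v, 'a) mpoly)" "\<zero>\<^bsub>mpoly_ring V\<^esub> = (0 :: ('v, 'a) mpoly)"
    "add (mpoly_ring V) = ((+) :: ('v, 'a) mpoly \<Rightarrow> _)"
    by (simp_all add: mpoly_ring_def C_def)
  show ?thesis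
  proof (rule cringI)
    show "abelian_group (mpoly_ring V :: ('v, 'a) mpoly ring)"
    proof (rule abelian_groupI, unfold sel)
      show "\<exists>q\<in>C. q + p = 0" if "p \<in> C" for p
        using neg[OF that] by (intro bexI[of _ "- p"]) simp_all
    qed (simp_all add: add zero add_ac)
    show "comm_monoid (mpoly_ring V :: ('v, 'a) mpoly ring)"
      by (rule comm_monoidI, unfold sel) (simp_all add: mult one mult_ac)
  qed (simp add: sel distrib_right)
qed

definition mpoly_eval :: "('a \<Rightarrow> 'b::comm_ring_1) \<Rightarrow> ('v \<Rightarrow> 'b) \<Rightarrow> ('v, 'a::comm_ring_1) mpoly \<Rightarrow> 'b" where
  "mpoly_eval h \<gamma> p = (\<Sum>t\<in>Poly_Mapping.keys p. h (Poly_Mapping.lookup p t) *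
     (\<Prod>v\<in>Poly_Mapping.keys t. \<gamma> v ^ Poly_Mapping.lookup t v))"

section \<open>Spectrum and Zariski topology\<close>

definition Spec :: "('a, 'm) ring_scheme \<Rightarrow> 'a set set" where
  "Spec R = {\<pp>. primeideal \<pp> R}"

definition zero_set :: "('a, 'm) ring_scheme \<Rightarrow> 'a set \<Rightarrow> 'a set set" where
  "zero_set R S = {\<pp> \<in> Spec R. S \<subseteq> \<pp>}"

definition zariski :: "('a, 'm) ring_scheme \<Rightarrow> 'a set topology" where
  "zariski R = topology (\<lambda>U. \<exists>S \<subseteq> carrier R. U = Spec R - zero_set R S)"

lemma openin_zariski:
  assumes "cring R"
  shows "openin (zariski R) U \<longleftrightarrow> (\<exists>S \<subseteq> carrier R. U = Spec R - zero_set R S)"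
proof -
  interpret cring R by fact
  let ?D = "\<lambda>S. Spec R - zero_set R S"
  have int: "\<exists>S \<subseteq> carrier R. ?D A \<inter> ?D B = ?D S"
    if AB: "A \<subseteq> carrier R" "B \<subseteq> carrier R" for A B
  proof (intro exI conjI)
    let ?S = "{a \<otimes>\<^bsub>R\<^esub> b | a b. a \<in> A \<and> b \<in> B}"
    show "?S \<subseteq> carrier R" using AB by auto
    have "?S \<subseteq> \<pp> \<longleftrightarrow> A \<subseteq> \<pp> \<or> B \<subseteq> \<pp>" if "primeideal \<pp> R" for \<pp>
    proof -
      interpret primeideal \<pp> R by fact
      show ?thesis
      proof
        assume S: "?S \<subseteq> \<pp>"
        show "A \<subseteq> \<pp> \<or> B \<subseteq> \<pp>"
        proof (rule ccontr)
          assume "\<not> (A \<subseteq> \<pp> \<or> B \<subseteq> \<pp>)"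
          then obtain a b where ab: "a \<in> A" "a \<notin> \<pp>" "b \<in> B" "b \<notin> \<pp>" by blast
          then have "a \<otimes>\<^bsub>R\<^esub> b \<in> \<pp>" using S by blast
          then show False using I_prime[of a b] ab AB by blast
        qed
      next
        assume "A \<subseteq> \<pp> \<or> B \<subseteq> \<pp>"
        then show "?S \<subseteq> \<pp>" using I_l_closed I_r_closed AB by blast
      qed
    qed
    then show "?D A \<inter> ?D B = ?D ?S" unfolding zero_set_def Spec_def by blast
  qed
  have un: "\<exists>S \<subseteq> carrier R. \<Union>\<U> = ?D S"
    if "\<forall>U\<in>\<U>. \<exists>S \<subseteq> carrier R. U = ?D S" for \<U>
  proof -
    from that obtain f where f: "\<And>U. U \<in> \<U> \<Longrightarrow> f U \<subseteq> carrier R \<and> U = ?D (f U)"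
      by metis
    have "\<Union>\<U> = (\<Union>U\<in>\<U>. ?D (f U))" using f by blast
    also have "\<dots> = ?D (\<Union>U\<in>\<U>. f U)" by (auto simp: zero_set_def)
    finally show ?thesis using f by (intro exI[of _ "\<Union>U\<in>\<U>. f U"]) blast
  qed
  have "istopology (\<lambda>U. \<exists>S \<subseteq> carrier R. U = ?D S)"
    unfolding istopology_def
  proof (intro conjI allI impI)
    fix U V assume "\<exists>S \<subseteq> carrier R. U = ?D S" "\<exists>S \<subseteq> carrier R. V = ?D S"
    then show "\<exists>S \<subseteq> carrier R. U \<inter> V = ?D S" using int by blast
  next
    fix \<U> assume "\<forall>U\<in>\<U>. \<exists>S \<subseteq> carrier R. U = ?D S"
    then show "\<exists>S \<subseteq> carrier R. \<Union>\<U> = ?D S" by (rule un)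
  qed
  then show ?thesis by (simp add: zariski_def)
qed

section \<open>Order ideals and affine Hilbert functions\<close>

definition order_ideal :: "nat \<Rightarrow> (nat \<Rightarrow>\<^sub>0 nat) set \<Rightarrow> bool" where
  "order_ideal n T \<longleftrightarrow> finite T \<and> T \<noteq> {} \<and> T \<subseteq> terms n \<and>
     (\<forall>t\<in>T. \<forall>s u. t = s + u \<longrightarrow> s \<in> T)"

text \<open>An order ideal together with its numbering $t_1, \ldots, t_\mu$ by non-decreasing degree.\<close>

definition ordered_order_ideal :: "nat \<Rightarrow> (nat \<Rightarrow>\<^sub>0 nat) list \<Rightarrow> bool" where
  "ordered_order_ideal n ts \<longleftrightarrow> order_ideal n (set ts) \<and> distinct ts \<and> sorted (map tdeg ts)"

definition border :: "nat \<Rightarrow> (nat \<Rightarrow>\<^sub>0 nat) set \<Rightarrow> (nat \<Rightarrow>\<^sub>0 nat) set" where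
  "border n T = (\<Union>r<n. (\<lambda>t. xvar r + t) ` T) - T"

definition HF_order_ideal :: "(nat \<Rightarrow>\<^sub>0 nat) set \<Rightarrow> nat \<Rightarrow> nat" where
  "HF_order_ideal T i = card {t \<in> T. tdeg t \<le> i}"

abbreviation affine_ring :: "nat \<Rightarrow> (nat, 'a::field) mpoly ring" where
  "affine_ring n \<equiv> mpoly_ring {..<n}"

definition coord_ring :: "nat \<Rightarrow> (nat, 'a::field) mpoly set \<Rightarrow> (nat, 'a) mpoly set ring" where
  "coord_ring n I = affine_ring n Quot I"

text \<open>The image of the base field in the coordinate ring, used as scalars for dimensions.\<close>

definition scalars :: "nat \<Rightarrow> (nat, 'a::field) mpoly set \<Rightarrow> (nat, 'a) mpoly set set" where
  "scalars n I = {I +>\<^bsub>affine_ring n\<^esub> monomial c 0 | c. True}"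

definition degree_filtration ::
    "nat \<Rightarrow> (nat, 'a::field) mpoly set \<Rightarrow> nat \<Rightarrow> (nat, 'a) mpoly set set" where
  "degree_filtration n I i = {I +>\<^bsub>affine_ring n\<^esub> p | p.
     p \<in> carrier (affine_ring n) \<and> (\<forall>t\<in>Poly_Mapping.keys p. tdeg t \<le> i)}"

definition HF_affine :: "nat \<Rightarrow> (nat, 'a::field) mpoly set \<Rightarrow> nat \<Rightarrow> nat" where
  "HF_affine n I i = ring.dim (coord_ring n I) (scalars n I) (degree_filtration n I i)"

text \<open>
  \<open>I\<close> is the vanishing ideal of a 0-dimensional subscheme of length \<open>\<mu>\<close> (for \<open>\<mu> \<ge> 1\<close>).
\<close>

definition zero_dim_ideal :: "nat \<Rightarrow> nat \<Rightarrow> (nat, 'a::field) mpoly set \<Rightarrow> bool" where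
  "zero_dim_ideal n \<mu> I \<longleftrightarrow> ideal I (affine_ring n) \<and>
     ring.dimension (coord_ring n I) \<mu> (scalars n I) (carrier (coord_ring n I))"

definition admissible :: "'a::field itself \<Rightarrow> nat \<Rightarrow> nat \<Rightarrow> (nat \<Rightarrow> nat) \<Rightarrow> bool" where
  "admissible _ n \<mu> H \<longleftrightarrow>
     (\<exists>I :: (nat, 'a) mpoly set. zero_dim_ideal n \<mu> I \<and> H = HF_affine n I)"

definition dominates :: "(nat \<Rightarrow> nat) \<Rightarrow> (nat \<Rightarrow> nat) \<Rightarrow> bool" where
  "dominates H H' \<longleftrightarrow> (\<forall>i. H i \<ge> H' i)"

definition strictly_dominates :: "(nat \<Rightarrow> nat) \<Rightarrow> (nat \<Rightarrow> nat) \<Rightarrow> bool" where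
  "strictly_dominates H H' \<longleftrightarrow> dominates H H' \<and> H \<noteq> H'"

section \<open>The border basis scheme\<close>

text \<open>
  In this section \<open>ts\<close> lists the order ideal and \<open>bs\<close> its border. The indeterminate
  $c_{ij}$ is the one indexed by the pair \<open>(i, j)\<close>. Subschemes of $\mathrm{Spec}(K[C])$ are
  considered up to radical, i.e. as locally closed subsets of the spectrum.
\<close>

type_synonym 'a cpoly = "(nat \<times> nat, 'a) mpoly"

definition coeff_ring ::
    "(nat \<Rightarrow>\<^sub>0 nat) list \<Rightarrow> (nat \<Rightarrow>\<^sub>0 nat) list \<Rightarrow> 'a::field cpoly ring" where
  "coeff_ring ts bs = mpoly_ring ({..<length ts} \<times> {..<length bs})"

definition generic_mult_mat ::
    "(nat \<Rightarrow>\<^sub>0 nat) list \<Rightarrow> (nat \<Rightarrow>\<^sub>0 nat) list \<Rightarrow> nat \<Rightarrow> 'a::field cpoly mat" where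
  "generic_mult_mat ts bs r = mat (length ts) (length ts) (\<lambda>(i, j).
     let s = xvar r + ts ! j in
     if s \<in> set ts then (if ts ! i = s then 1 else 0)
     else monomial 1 (xvar (i, THE m. m < length bs \<and> bs ! m = s)))"

definition border_scheme_ideal ::
    "nat \<Rightarrow> (nat \<Rightarrow>\<^sub>0 nat) list \<Rightarrow> (nat \<Rightarrow>\<^sub>0 nat) list \<Rightarrow> 'a::field cpoly set" where
  "border_scheme_ideal n ts bs = Idl\<^bsub>coeff_ring ts bs\<^esub>
     {(generic_mult_mat ts bs r * generic_mult_mat ts bs s
       - generic_mult_mat ts bs s * generic_mult_mat ts bs r) $$ (i, j) | r s i j.
       r < n \<and> s < n \<and> i < length ts \<and> j < length ts}"

definition border_scheme ::
    "nat \<Rightarrow> (nat \<Rightarrow>\<^sub>0 nat) list \<Rightarrow> (nat \<Rightarrow>\<^sub>0 nat) list \<Rightarrow> 'a::field cpoly set set" where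
  "border_scheme n ts bs = zero_set (coeff_ring ts bs) (border_scheme_ideal n ts bs)"

text \<open>
  Rational points are taken over the algebraic closure of the base field. A point is the matrix
  $\Gamma = (\gamma_{ij})$.
\<close>

definition eval_at :: "'a::field alg_closure mat \<Rightarrow> 'a cpoly \<Rightarrow> 'a alg_closure" where
  "eval_at \<Gamma> f = mpoly_eval to_ac (\<lambda>ij. \<Gamma> $$ ij) f"

definition rational_points ::
    "nat \<Rightarrow> (nat \<Rightarrow>\<^sub>0 nat) list \<Rightarrow> (nat \<Rightarrow>\<^sub>0 nat) list \<Rightarrow> 'a::field alg_closure mat set" where
  "rational_points n ts bs = {\<Gamma> \<in> carrier_mat (length ts) (length bs).
     \<forall>f \<in> border_scheme_ideal n ts bs. eval_at \<Gamma> f = 0}"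

text \<open>The point of $\mathrm{Spec}(K[C])$ underlying \<open>\<Gamma>\<close>: the kernel of evaluation at \<open>\<Gamma>\<close>.\<close>

definition spec_point ::
    "(nat \<Rightarrow>\<^sub>0 nat) list \<Rightarrow> (nat \<Rightarrow>\<^sub>0 nat) list \<Rightarrow> 'a::field alg_closure mat \<Rightarrow> 'a cpoly set" where
  "spec_point ts bs \<Gamma> = {f \<in> carrier (coeff_ring ts bs). eval_at \<Gamma> f = 0}"

definition point_ideal ::
    "nat \<Rightarrow> (nat \<Rightarrow>\<^sub>0 nat) list \<Rightarrow> (nat \<Rightarrow>\<^sub>0 nat) list \<Rightarrow> 'b::field mat \<Rightarrow> (nat, 'b) mpoly set" where
  "point_ideal n ts bs \<Gamma> = Idl\<^bsub>affine_ring n\<^esub>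
     {monomial 1 (bs ! j) - (\<Sum>i<length ts. monomial (\<Gamma> $$ (i, j)) (ts ! i)) | j. j < length bs}"

text \<open>The closed stratum $\mathbb{B}_{\mathcal{O}}(\overline{\mathcal{H}})$.\<close>

definition closed_stratum ::
    "nat \<Rightarrow> (nat \<Rightarrow>\<^sub>0 nat) list \<Rightarrow> (nat \<Rightarrow>\<^sub>0 nat) list \<Rightarrow> (nat \<Rightarrow> nat) \<Rightarrow> 'a::field cpoly set set" where
  "closed_stratum n ts bs H =
     subtopology (zariski (coeff_ring ts bs)) (border_scheme n ts bs) closure_of
       (spec_point ts bs ` {\<Gamma> \<in> rational_points n ts bs.
          dominates H (HF_affine n (point_ideal n ts bs \<Gamma>))})"

text \<open>The stratum $\mathbb{B}_{\mathcal{O}}(\mathcal{H})$.\<close>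

definition stratum ::
    "nat \<Rightarrow> (nat \<Rightarrow>\<^sub>0 nat) list \<Rightarrow> (nat \<Rightarrow>\<^sub>0 nat) list \<Rightarrow> (nat \<Rightarrow> nat) \<Rightarrow> 'a::field cpoly set set" where
  "stratum n ts bs H = closed_stratum n ts bs H -
     subtopology (zariski (coeff_ring ts bs)) (border_scheme n ts bs) closure_of
       (spec_point ts bs ` {\<Gamma> \<in> rational_points n ts bs.
          strictly_dominates H (HF_affine n (point_ideal n ts bs \<Gamma>))})"

text \<open>
  $t(\mathcal{A}_1, \ldots, \mathcal{A}_n)$. The generic multiplication matrices do not commute, so
  the factors are multiplied in the order of the indeterminates.
\<close>

definition term_mat ::
    "nat \<Rightarrow> (nat \<Rightarrow>\<^sub>0 nat) list \<Rightarrow> (nat \<Rightarrow>\<^sub>0 nat) list \<Rightarrow> (nat \<Rightarrow>\<^sub>0 nat) \<Rightarrow> 'a::field cpoly mat" where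
  "term_mat n ts bs t =
     foldr (\<lambda>r M. (generic_mult_mat ts bs r ^\<^sub>m Poly_Mapping.lookup t r) * M) [0..<n] (1\<^sub>m (length ts))"

definition dfb_mat ::
    "nat \<Rightarrow> (nat \<Rightarrow>\<^sub>0 nat) list \<Rightarrow> (nat \<Rightarrow>\<^sub>0 nat) list \<Rightarrow> (nat \<Rightarrow>\<^sub>0 nat) list \<Rightarrow> 'a::field cpoly mat" where
  "dfb_mat n ts bs ts' = mat_of_cols (length ts) (map (\<lambda>t'. col (term_mat n ts bs t') 0) ts')"

text \<open>$\mathbb{B}^{\mathrm{dfb}}_{\mathcal{O}}(\mathcal{O}')$ for the order ideal listed by \<open>ts'\<close>.\<close>

definition dfb_locus ::
    "nat \<Rightarrow> (nat \<Rightarrow>\<^sub>0 nat) list \<Rightarrow> (nat \<Rightarrow>\<^sub>0 nat) list \<Rightarrow> (nat \<Rightarrow>\<^sub>0 nat) list \<Rightarrow> 'a::field cpoly set set" where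
  "dfb_locus n ts bs ts' = stratum n ts bs (HF_order_ideal (set ts')) -
     zero_set (coeff_ring ts bs) {det (dfb_mat n ts bs ts')}"

end

theory Submission
  imports Defs "Jordan_Normal_Form.Char_Poly"
begin

text \<open>
  The loci are the traces on the stratum of the open sets where one determinant does not vanish, and
  the stratum is the complement of a closed set in the closed stratum; both openness claims follow.
  The content is the covering: at a prime $\mathfrak{p}$ of the stratum, some determinant
  $\det(T')$ of an order ideal with affine Hilbert function $H$ lies outside $\mathfrak{p}$
  (\<open>stratum_covering\<close>).

  Suppose that all of them lie in $\mathfrak{p}$. As $\mathfrak{p}$ is outside the closure of the
  points with Hilbert function strictly below $H$, some $f \notin \mathfrak{p}$ vanishes at all
  these points. The Nullstellensatz gives a point $\Gamma$ over the algebraic closure at which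
  $\mathfrak{p}$ vanishes and $f$ does not. From here on all linear algebra takes place in the rings
  $R_\Gamma$. The terms that are no linear combination of smaller terms modulo $I_\Gamma$, for a
  degree compatible term ordering, form an order ideal $T$ and a degree filtered basis of
  $R_\Gamma$ (\<open>standard_terms_order_ideal\<close>), so $T$ and $R_\Gamma$ have the same
  affine Hilbert function. The determinant of $T$ does not vanish at $\Gamma$, hence it is not in
  $\mathfrak{p}$. But $\mathfrak{p}$ is in the closure of the points whose Hilbert function is
  dominated by $H$, so this determinant is nonzero at one such point $\Gamma'$. There the terms of
  $T$ are again linearly independent, and counting those of degree at most $i$ shows that the
  Hilbert function of $R_\Gamma$ is dominated by that of $R_{\Gamma'}$
  (\<open>HF_ge_of_det_nonzero\<close>), hence by $H$. If it equals $H$, then $T$ is one of the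
  given order ideals and its determinant lies in $\mathfrak{p}$, so it vanishes at $\Gamma$, a
  contradiction. Otherwise it is strictly below $H$, so $f(\Gamma) = 0$, again a contradiction.

  The bridge between determinants and bases is \<open>det_dfb_mat_nonzero_iff\<close>. At a point
  $\Gamma$ of the scheme the multiplication matrices commute, so $p \mapsto p(A_1, \ldots, A_n) e_1$
  is linear with an ideal as kernel. It maps $t_j$ to $e_j$ and $b_j$ to the $j$-th column of
  $\Gamma$, whence its kernel is $I_\Gamma$, and its values at terms are the columns of the matrix
  of the determinant.

  The Nullstellensatz is proved by induction on the number of indeterminates. For a prime $P$ of
  $S[X]$ and $f \notin P$ there is an element $b \in S \setminus P$ such that every homomorphism
  from $S$ to an algebraically closed field that kills $P \cap S$ but not $b$ extends to $S[X]$ in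
  such a way that $P$ is killed and $f$ is not (\<open>prime_extension\<close>).
\<close>

section \<open>Extending homomorphisms to a univariate polynomial ring\<close>

text \<open>
  Subrings and their primes are subsets of a ring type, because the induction over the
  indeterminates runs through the subrings $K[W]$ of a single type of polynomials.
\<close>

definition subring_of :: "'a::comm_ring_1 set \<Rightarrow> bool" where
  "subring_of S \<longleftrightarrow> 0 \<in> S \<and> 1 \<in> S \<and> (\<forall>a\<in>S. \<forall>b\<in>S. a + b \<in> S \<and> a * b \<in> S) \<and> (\<forall>a\<in>S. - a \<in> S)"

definition prime_of :: "'a::comm_ring_1 set \<Rightarrow> 'a set \<Rightarrow> bool" where
  "prime_of S P \<longleftrightarrow> P \<subseteq> S \<and> 0 \<in> P \<and> 1 \<notin> P \<and> (\<forall>a\<in>P. \<forall>b\<in>P. a + b \<in> P)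
     \<and> (\<forall>a\<in>S. \<forall>b\<in>P. a * b \<in> P) \<and> (\<forall>a\<in>S. \<forall>b\<in>S. a * b \<in> P \<longrightarrow> a \<in> P \<or> b \<in> P)"

definition polys_with_coeffs :: "'a::comm_ring_1 set \<Rightarrow> 'a poly set" where
  "polys_with_coeffs S = {p. \<forall>i. coeff p i \<in> S}"

lemma subring_ofD:
  assumes "subring_of S"
  shows "0 \<in> S" "1 \<in> S" "\<And>a b. a \<in> S \<Longrightarrow> b \<in> S \<Longrightarrow> a + b \<in> S"
    "\<And>a b. a \<in> S \<Longrightarrow> b \<in> S \<Longrightarrow> a * b \<in> S" "\<And>a. a \<in> S \<Longrightarrow> - a \<in> S"
    "\<And>a b. a \<in> S \<Longrightarrow> b \<in> S \<Longrightarrow> a - b \<in> S" "\<And>a k. a \<in> S \<Longrightarrow> a ^ k \<in> S"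
    "\<And>F I. (\<And>i. i \<in> I \<Longrightarrow> F i \<in> S) \<Longrightarrow> (\<Sum>i\<in>I. F i) \<in> S"
proof -
  note S = assms[unfolded subring_of_def]
  show "0 \<in> S" "1 \<in> S" "\<And>a b. a \<in> S \<Longrightarrow> b \<in> S \<Longrightarrow> a + b \<in> S"
    "\<And>a b. a \<in> S \<Longrightarrow> b \<in> S \<Longrightarrow> a * b \<in> S" "\<And>a. a \<in> S \<Longrightarrow> - a \<in> S"
    using S by auto
  show "a - b \<in> S" if "a \<in> S" "b \<in> S" for a b
    using S that by (metis diff_conv_add_uminus)
  show "a ^ k \<in> S" if "a \<in> S" for a k
    using S that by (induction k) auto
  show "(\<Sum>i\<in>I. F i) \<in> S" if "\<And>i. i \<in> I \<Longrightarrow> F i \<in> S" for F :: "'b \<Rightarrow> _" and I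
    using S that by (induction I rule: infinite_finite_induct) auto
qed

lemma prime_ofD:
  assumes "subring_of S" "prime_of S P"
  shows "P \<subseteq> S" "0 \<in> P" "1 \<notin> P" "\<And>a b. a \<in> P \<Longrightarrow> b \<in> P \<Longrightarrow> a + b \<in> P"
    "\<And>a b. a \<in> S \<Longrightarrow> b \<in> P \<Longrightarrow> a * b \<in> P" "\<And>a b. a \<in> P \<Longrightarrow> b \<in> S \<Longrightarrow> a * b \<in> P"
    "\<And>a b. a \<in> S \<Longrightarrow> b \<in> S \<Longrightarrow> a * b \<in> P \<Longrightarrow> a \<in> P \<or> b \<in> P"
    "\<And>a b. a \<in> P \<Longrightarrow> b \<in> P \<Longrightarrow> a - b \<in> P"
    "\<And>F I. (\<And>i. i \<in> I \<Longrightarrow> F i \<in> P) \<Longrightarrow> (\<Sum>i\<in>I. F i) \<in> P"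
    "\<And>a k. a \<in> S \<Longrightarrow> a ^ k \<in> P \<Longrightarrow> a \<in> P"
proof -
  note P = assms(2)[unfolded prime_of_def] and S = subring_ofD[OF assms(1)]
  show 1: "P \<subseteq> S" "0 \<in> P" "1 \<notin> P" "\<And>a b. a \<in> P \<Longrightarrow> b \<in> P \<Longrightarrow> a + b \<in> P"
    "\<And>a b. a \<in> S \<Longrightarrow> b \<in> P \<Longrightarrow> a * b \<in> P"
    and prime: "\<And>a b. a \<in> S \<Longrightarrow> b \<in> S \<Longrightarrow> a * b \<in> P \<Longrightarrow> a \<in> P \<or> b \<in> P"
    using P by auto
  show "\<And>a b. a \<in> P \<Longrightarrow> b \<in> S \<Longrightarrow> a * b \<in> P"
    using 1(5) by (metis mult.commute)
  show "a - b \<in> P" if "a \<in> P" "b \<in> P" for a b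
    using 1(4)[OF that(1) 1(5)[OF S(5)[OF S(2)] that(2)]] by simp
  show "(\<Sum>i\<in>I. F i) \<in> P" if "\<And>i. i \<in> I \<Longrightarrow> F i \<in> P" for F :: "'b \<Rightarrow> _" and I
    using P that by (induction I rule: infinite_finite_induct) auto
  show "a \<in> P" if "a \<in> S" "a ^ k \<in> P" for a k
    using that(2)
  proof (induction k)
    case (Suc k)
    then show ?case using prime[of a "a ^ k"] S(7)[OF that(1)] that(1) by auto
  qed (use 1 in auto)
qed

lemma subring_polys_with_coeffs:
  assumes "subring_of S"
  shows "subring_of (polys_with_coeffs S)"
proof -
  note S = subring_ofD[OF assms]
  have "p * q \<in> polys_with_coeffs S" if "p \<in> polys_with_coeffs S" "q \<in> polys_with_coeffs S" for p q
    using that unfolding polys_with_coeffs_def by (auto simp: coeff_mult intro!: S(8) S(4))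
  then show ?thesis
    using S unfolding subring_of_def by (auto simp: polys_with_coeffs_def coeff_1)
qed

lemma monom_in_polys_with_coeffs:
  "subring_of S \<Longrightarrow> c \<in> S \<Longrightarrow> monom c k \<in> polys_with_coeffs S"
  using subring_ofD(1) by (auto simp: polys_with_coeffs_def)

lemma smult_in_polys_with_coeffs:
  "subring_of S \<Longrightarrow> c \<in> S \<Longrightarrow> p \<in> polys_with_coeffs S \<Longrightarrow> smult c p \<in> polys_with_coeffs S"
  using subring_ofD(4) by (auto simp: polys_with_coeffs_def)

text \<open>
  Think of polynomials over the fraction field of $S/Q$. If the coefficient of \<open>h\<close> at \<open>d\<close> is
  nonzero there, then \<open>h\<close> has degree \<open>d\<close>, which is the least degree of a nonzero element of the
  ideal \<open>J\<close>, and so \<open>h\<close> generates \<open>J\<close>. Clearing denominators turns divisibility by \<open>h\<close> into a statement about $S$. The proof is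
  long division: each step cancels the coefficient of highest degree that is not in \<open>Q\<close>.
\<close>

lemma pseudo_division_modulo_prime:
  assumes S: "subring_of S" and Q: "prime_of S Q"
    and add: "\<And>p q. p \<in> J \<Longrightarrow> q \<in> J \<Longrightarrow> p + q \<in> J"
    and mult: "\<And>p q. p \<in> polys_with_coeffs S \<Longrightarrow> q \<in> J \<Longrightarrow> p * q \<in> J"
    and h: "h \<in> J" "J \<subseteq> polys_with_coeffs S" "\<And>i. i > d \<Longrightarrow> coeff h i \<in> Q"
    and min: "\<And>p. p \<in> J \<Longrightarrow> (\<And>i. i \<ge> d \<Longrightarrow> coeff p i \<in> Q) \<Longrightarrow> p \<in> polys_with_coeffs Q"
    and p: "p \<in> J"
  shows "\<exists>N. \<exists>q\<in>polys_with_coeffs S. smult (coeff h d ^ N) p - q * h \<in> polys_with_coeffs Q"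
proof -
  let ?c = "coeff h d"
  note S' = subring_ofD[OF S] and SX = subring_ofD[OF subring_polys_with_coeffs[OF S]]
    and Q' = prime_ofD[OF S Q]
  have c: "?c \<in> S" using h by (auto simp: polys_with_coeffs_def)
  have "\<exists>N. \<exists>q\<in>polys_with_coeffs S. smult (?c ^ N) p - q * h \<in> polys_with_coeffs Q"
    if "p \<in> J" "\<And>i. i \<ge> e \<Longrightarrow> coeff p i \<in> Q" for e p
    using that
  proof (induction e arbitrary: p)
    case 0
    then have "p \<in> polys_with_coeffs Q" by (simp add: polys_with_coeffs_def)
    then show ?case using SX(1) by (intro exI[of _ 0] bexI[of _ 0]) auto
  next
    case (Suc e)
    show ?case
    proof (cases "e < d")
      case True
      then have "p \<in> polys_with_coeffs Q" using min[OF Suc.prems(1)] Suc.prems(2) by auto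
      then show ?thesis using SX(1) by (intro exI[of _ 0] bexI[of _ 0]) auto
    next
      case False
      define m where "m = monom (coeff p e) (e - d)"
      define p' where "p' = smult ?c p - m * h"
      have m: "m \<in> polys_with_coeffs S"
        using Suc.prems(1) h(2) unfolding m_def
        by (intro monom_in_polys_with_coeffs[OF S]) (auto simp: polys_with_coeffs_def)
      have "p' = [:?c:] * p + (- m) * h" unfolding p'_def by simp
      also have "\<dots> \<in> J"
        using Suc.prems(1) h(1) m SX(5) c S'(1)
        by (intro add mult) (auto simp: polys_with_coeffs_def coeff_pCons split: nat.split)
      finally have J: "p' \<in> J" .
      have "coeff p' i \<in> Q" if i: "i \<ge> e" for i
      proof (cases "i = e")
        case True
        then show ?thesis using False Q'(2)
          by (simp add: p'_def m_def coeff_monom_mult mult.commute[of "coeff h d"])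
      next
        case i': False
        have "coeff p' i = ?c * coeff p i - coeff p e * coeff h (i - (e - d))"
          using i False by (simp add: p'_def m_def coeff_monom_mult)
        also have "\<dots> \<in> Q"
          using i i' False c Suc.prems(1) h(2) by (intro Q'(8) Q'(5) Suc.prems(2) h(3))
            (auto simp: polys_with_coeffs_def)
        finally show ?thesis .
      qed
      from Suc.IH[OF J this] obtain N q where q: "q \<in> polys_with_coeffs S"
        "smult (?c ^ N) p' - q * h \<in> polys_with_coeffs Q" by blast
      have "smult (?c ^ N) p' - q * h = smult (?c ^ Suc N) p - (smult (?c ^ N) m + q) * h"
        unfolding p'_def by (simp add: algebra_simps smult_diff_right smult_add_right)
      then show ?thesis
        using q m c by (intro exI[of _ "Suc N"] bexI[of _ "smult (?c ^ N) m + q"])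
          (auto intro!: SX(3) smult_in_polys_with_coeffs[OF S] S'(7))
    qed
  qed
  moreover have "coeff p i \<in> Q" if "i \<ge> Suc (degree p)" for i
    using that Q'(2) by (simp add: coeff_eq_0)
  ultimately show ?thesis using p by blast
qed

text \<open>
  If the field were finite, then $1 + \prod_a (X - a)$ would have no root.
\<close>

lemma infinite_UNIV_alg_closed: "infinite (UNIV :: 'l::alg_closed_field set)"
proof
  assume fin: "finite (UNIV :: 'l set)"
  define p where "p = (\<Prod>a\<in>UNIV. [:- a, 1:]) + (1 :: 'l poly)"
  have "degree (\<Prod>a\<in>UNIV. [:- a, 1:] :: 'l poly) = card (UNIV :: 'l set)"
    by (subst degree_prod_eq_sum_degree) auto
  moreover have "card (UNIV :: 'l set) > 0" using fin by (simp add: card_gt_0_iff)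
  ultimately have "degree p > 0" unfolding p_def by (simp add: degree_add_eq_left)
  then obtain x where "poly p x = 0" using alg_closed_imp_poly_has_root by blast
  moreover have "(\<Prod>a\<in>UNIV. poly [:- a, 1:] x) = 0"
    using fin by (intro prod_zero bexI[of _ x]) auto
  ultimately show False by (simp add: p_def poly_prod)
qed

text \<open>
  Let $Q = P \cap S$ and work over the fraction field of $S/Q$. If $P$ becomes zero there, then
  $P = Q[X]$, some coefficient $b$ of $f$ is outside $Q$, and almost every value of $X$ will do.
  Otherwise $P$ is generated by an element \<open>g\<close> of minimal positive degree; as $P$ is prime, \<open>g\<close> is
  irreducible and does not divide $f$, so the ideal generated by $P$ and $f$ contains a nonzero
  constant \<open>c\<close>. Let $b$ be the product of \<open>c\<close> and the leading coefficient of \<open>g\<close>. If $b$ is not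
  killed, then \<open>g\<close> keeps its positive degree and has a root; the root annihilates all of $P$, and
  cannot annihilate $f$ since it would then annihilate \<open>c\<close>.
\<close>

lemma prime_extension:
  assumes S: "subring_of S" and P: "prime_of (polys_with_coeffs S) P"
    and f: "f \<in> polys_with_coeffs S" "f \<notin> P"
  shows "\<exists>b\<in>S. [:b:] \<notin> P \<and> (\<forall>\<phi> :: 'a::comm_ring_1 \<Rightarrow> 'l::alg_closed_field. comm_ring_hom \<phi> \<longrightarrow>
     (\<forall>c\<in>S. [:c:] \<in> P \<longrightarrow> \<phi> c = 0) \<longrightarrow> \<phi> b \<noteq> 0 \<longrightarrow>
     (\<exists>x. (\<forall>p\<in>P. poly (map_poly \<phi> p) x = 0) \<and> poly (map_poly \<phi> f) x \<noteq> 0))"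
proof -
  define Q where "Q = {c \<in> S. [:c:] \<in> P}"
  let ?SX = "polys_with_coeffs S" and ?QX = "polys_with_coeffs Q"
  note S' = subring_ofD[OF S] and SX = subring_ofD[OF subring_polys_with_coeffs[OF S]]
    and P' = prime_ofD[OF subring_polys_with_coeffs[OF S] P]
  have C: "[:c:] \<in> ?SX" if "c \<in> S" for c
    using monom_in_polys_with_coeffs[OF S that, of 0] by (simp add: monom_0)
  have Q: "prime_of S Q"
    unfolding prime_of_def
  proof (intro conjI ballI impI)
    show "Q \<subseteq> S" "0 \<in> Q" "1 \<notin> Q" using S' P' by (auto simp: Q_def simp flip: one_pCons)
    show "a + b \<in> Q" if "a \<in> Q" "b \<in> Q" for a b
      using that P'(4)[of "[:a:]" "[:b:]"] S' by (auto simp: Q_def)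
    show "a * b \<in> Q" if "a \<in> S" "b \<in> Q" for a b
      using that P'(5)[OF C, of a "[:b:]"] S'(4) by (auto simp: Q_def mult.commute)
    show "a \<in> Q \<or> b \<in> Q" if "a \<in> S" "b \<in> S" "a * b \<in> Q" for a b
      using that P'(7)[OF C C, of a b] by (auto simp: Q_def mult.commute)
  qed
  note Q' = prime_ofD[OF S Q]
  have QX: "?QX \<subseteq> P"
  proof
    fix p assume p: "p \<in> ?QX"
    have "monom (coeff p i) i \<in> P" for i
    proof -
      have eq: "monom (coeff p i) i = monom 1 i * [:coeff p i:]"
        by (simp add: mult_monom flip: monom_0)
      show ?thesis unfolding eq using p
        by (intro P'(5) monom_in_polys_with_coeffs[OF S S'(2)])
          (auto simp: polys_with_coeffs_def Q_def)
    qed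
    then have "(\<Sum>i\<le>degree p. monom (coeff p i) i) \<in> P" by (intro P'(9)) auto
    then show "p \<in> P" by (simp add: poly_as_sum_of_monoms)
  qed
  have QS: "?QX \<subseteq> ?SX" using QX P'(1) by blast
  have coeffS: "coeff p i \<in> S" if "p \<in> ?SX" for p i using that by (auto simp: polys_with_coeffs_def)
  \<comment> \<open>An element of least degree modulo \<open>Q\<close>, where coefficients in \<open>Q\<close> do not count for the degree.\<close>
  have least: "\<exists>h d. h \<in> J \<and> coeff h d \<notin> Q \<and> (\<forall>i>d. coeff h i \<in> Q) \<and>
     (\<forall>p\<in>J. (\<forall>i\<ge>d. coeff p i \<in> Q) \<longrightarrow> p \<in> ?QX)" if "p0 \<in> J" "p0 \<notin> ?QX" for J p0
  proof -
    have top: "\<exists>d. coeff p d \<notin> Q \<and> (\<forall>i>d. coeff p i \<in> Q)" if "p \<notin> ?QX" for p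
    proof -
      obtain i where i: "coeff p i \<notin> Q" using \<open>p \<notin> ?QX\<close> by (auto simp: polys_with_coeffs_def)
      have "\<forall>i. coeff p i \<notin> Q \<longrightarrow> i \<le> degree p"
        using Q'(2) by (metis le_degree)
      from GreatestI_nat[where P="\<lambda>i. coeff p i \<notin> Q", OF i, of "degree p"]
        Greatest_le_nat[where P="\<lambda>i. coeff p i \<notin> Q" and b="degree p"] this
      show ?thesis by (metis leD)
    qed
    define D where "D = (\<lambda>d. \<exists>h\<in>J. coeff h d \<notin> Q \<and> (\<forall>i>d. coeff h i \<in> Q))"
    have "\<exists>d. D d" using top[OF that(2)] that(1) unfolding D_def by blast
    define m where "m = (LEAST d. D d)"
    have "D m" using \<open>\<exists>d. D d\<close> unfolding m_def by (rule LeastI_ex)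
    then obtain h where h: "h \<in> J" "coeff h m \<notin> Q" "\<forall>i>m. coeff h i \<in> Q"
      unfolding D_def by blast
    have "p \<in> ?QX" if p: "p \<in> J" "\<forall>i\<ge>m. coeff p i \<in> Q" for p
    proof (rule ccontr)
      assume "p \<notin> ?QX"
      from top[OF this] obtain k where k: "coeff p k \<notin> Q" "\<forall>i>k. coeff p i \<in> Q" by blast
      then have "D k" using p unfolding D_def by blast
      then have "m \<le> k" unfolding m_def by (rule Least_le)
      then show False using k p by blast
    qed
    then show ?thesis using h by blast
  qed
  have hom0: "map_poly \<phi> p = 0" if "comm_ring_hom \<phi>" "\<forall>c\<in>Q. \<phi> c = 0" "p \<in> ?QX" for \<phi> :: "'a \<Rightarrow> 'l" and p
  proof -
    interpret comm_ring_hom \<phi> by fact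
    show ?thesis using that(2,3) by (intro poly_eqI) (auto simp: polys_with_coeffs_def)
  qed
  show ?thesis
  proof (cases "P \<subseteq> ?QX")
    case True
    then obtain i where i: "coeff f i \<notin> Q" using f(2) QX by (auto simp: polys_with_coeffs_def)
    have "\<exists>x. (\<forall>p\<in>P. poly (map_poly \<phi> p) x = 0) \<and> poly (map_poly \<phi> f) x \<noteq> 0"
      if \<phi>: "comm_ring_hom \<phi>" "\<forall>c\<in>S. [:c:] \<in> P \<longrightarrow> \<phi> c = 0" "\<phi> (coeff f i) \<noteq> 0" for \<phi> :: "'a \<Rightarrow> 'l"
    proof -
      interpret comm_ring_hom \<phi> by fact
      have "coeff (map_poly \<phi> f) i \<noteq> 0" using \<phi>(3) by simp
      then have "map_poly \<phi> f \<noteq> 0" by (metis coeff_0)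
      then have "finite {x. poly (map_poly \<phi> f) x = 0}" by (rule poly_roots_finite)
      then obtain x where "poly (map_poly \<phi> f) x \<noteq> 0"
        using infinite_UNIV_alg_closed[where 'l='l] by (metis (mono_tags) UNIV_eq_I mem_Collect_eq)
      moreover have "map_poly \<phi> p = 0" if "p \<in> P" for p
        using hom0[OF \<phi>(1), of p] \<phi>(2) True that by (auto simp: Q_def)
      ultimately show ?thesis by auto
    qed
    then show ?thesis using i coeffS[OF f(1)] by (intro bexI[of _ "coeff f i"]) (auto simp: Q_def)
  next
    case False
    then obtain p0 where "p0 \<in> P" "p0 \<notin> ?QX" by blast
    from least[OF this] obtain g d where g: "g \<in> P" "coeff g d \<notin> Q" "\<And>i. i > d \<Longrightarrow> coeff g i \<in> Q"
      and gmin: "\<And>p. p \<in> P \<Longrightarrow> (\<And>i. i \<ge> d \<Longrightarrow> coeff p i \<in> Q) \<Longrightarrow> p \<in> ?QX" by blast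
    have gS: "g \<in> ?SX" using g P' by blast
    have const: "h - [:coeff h 0:] \<in> ?QX" if "\<And>i. i > 0 \<Longrightarrow> coeff h i \<in> Q" for h
      using that Q'(2) by (auto simp: polys_with_coeffs_def coeff_pCons split: nat.split)
    have d: "d > 0"
    proof (rule ccontr)
      assume "\<not> d > 0"
      then have d0: "d = 0" by simp
      have "g - [:coeff g 0:] \<in> P" using const[of g] g(3) QX unfolding d0 by blast
      then have "g - (g - [:coeff g 0:]) \<in> P" using g(1) P'(8) by blast
      then show False using g(2) coeffS[OF gS] unfolding d0 by (simp add: Q_def)
    qed
    \<comment> \<open>The ideal generated by \<open>f\<close> and \<open>P\<close>; its generator \<open>h\<close> will turn out to be constant modulo \<open>Q\<close>.\<close>
    define J where "J = {u * f + w | u w. u \<in> ?SX \<and> w \<in> P}"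
    have PJ: "P \<subseteq> J" using SX(1) by (force simp: J_def)
    have fJ: "f \<in> J" using SX(2) P'(2) by (force simp: J_def)
    have JS: "J \<subseteq> ?SX" using f P'(1) by (auto simp: J_def intro!: SX(3) SX(4))
    have Jadd: "p + q \<in> J" if pq: "p \<in> J" "q \<in> J" for p q
    proof -
      obtain u w u' w' where "u \<in> ?SX" "w \<in> P" "u' \<in> ?SX" "w' \<in> P" "p = u * f + w" "q = u' * f + w'"
        using pq unfolding J_def by blast
      then have "p + q = (u + u') * f + (w + w')" "u + u' \<in> ?SX" "w + w' \<in> P"
        using SX(3) P'(4) by (auto simp: algebra_simps)
      then show ?thesis unfolding J_def by blast
    qed
    have Jmult: "p * q \<in> J" if pq: "p \<in> ?SX" "q \<in> J" for p q
    proof -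
      obtain u w where "u \<in> ?SX" "w \<in> P" "q = u * f + w"
        using pq unfolding J_def by blast
      then have "p * q = (p * u) * f + p * w" "p * u \<in> ?SX" "p * w \<in> P"
        using pq SX(4) P'(5) by (auto simp: algebra_simps)
      then show ?thesis unfolding J_def by blast
    qed
    have gJ: "g \<in> J" and gQ: "g \<notin> ?QX" using g PJ by (auto simp: polys_with_coeffs_def)
    obtain h e where h: "h \<in> J" "coeff h e \<notin> Q" "\<And>i. i > e \<Longrightarrow> coeff h i \<in> Q"
      and hmin: "\<And>p. p \<in> J \<Longrightarrow> (\<And>i. i \<ge> e \<Longrightarrow> coeff p i \<in> Q) \<Longrightarrow> p \<in> ?QX"
using least[OF gJ gQ] by blast
    have hS: "h \<in> ?SX" using h JS by blast
    have divJ: "\<exists>N. \<exists>q\<in>?SX. smult (coeff h e ^ N) p - q * h \<in> ?QX" if "p \<in> J" for p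
      by (rule pseudo_division_modulo_prime[OF S Q, where J=J])
        (fact Jadd Jmult h(1) JS h(3) hmin that)+
    have divP: "\<exists>N. \<exists>q\<in>?SX. smult (coeff g d ^ N) p - q * g \<in> ?QX" if "p \<in> P" for p
      by (rule pseudo_division_modulo_prime[OF S Q, where J=P])
        (fact P'(4) P'(5) g(1) P'(1) g(3) gmin that)+
    let ?a = "coeff g d" and ?c = "coeff h e"
    have a: "?a \<in> S" and c: "?c \<in> S" using coeffS gS hS by auto
    have powQ: "x ^ N \<notin> Q" if "x \<in> S" "x \<notin> Q" for x N using Q'(10) that by blast
    \<comment> \<open>Up to constants, \<open>g\<close> and \<open>f\<close> are multiples of \<open>h\<close> modulo \<open>Q\<close>. As \<open>P\<close> is prime, \<open>h\<close> or the cofactor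
      of \<open>g\<close> is in \<open>P\<close>. The former puts \<open>f\<close> into \<open>P\<close>; the latter contradicts the minimality of \<open>g\<close> if
      \<open>h\<close> is not constant.\<close>
    have e: "e = 0"
    proof (rule ccontr)
      assume "e \<noteq> 0"
      obtain N q where q: "q \<in> ?SX" "smult (?c ^ N) g - q * h \<in> ?QX" using divJ[OF gJ] by blast
      obtain M q' where q': "q' \<in> ?SX" "smult (?c ^ M) f - q' * h \<in> ?QX" using divJ[OF fJ] by blast
      have gP: "smult (?c ^ N) g \<in> P" using P'(5)[OF C[OF S'(7)[OF c]] g(1)] by simp
      have "q * h = smult (?c ^ N) g - (smult (?c ^ N) g - q * h)" by simp
      also have "\<dots> \<in> P" using P'(8)[OF gP] QX q(2) by blast
      finally have qh: "q * h \<in> P" .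
      have "h \<notin> P"
      proof
        assume "h \<in> P"
        have "(smult (?c ^ M) f - q' * h) + q' * h \<in> P"
          using QX q' \<open>h \<in> P\<close> by (intro P'(4) P'(5)) auto
        then have "[:?c ^ M:] * f \<in> P" by simp
        then have "[:?c ^ M:] \<in> P" using P'(7)[OF C[OF S'(7)[OF c]] f(1)] f(2) by blast
        then show False using powQ[OF c h(2), of M] S'(7)[OF c] by (auto simp: Q_def)
      qed
      then have qP: "q \<in> P" using P'(7)[OF q(1) hS qh] by blast
      have "q \<notin> ?QX"
      proof
        assume "q \<in> ?QX"
        then have "coeff (q * h) d \<in> Q" unfolding coeff_mult
          using coeffS[OF hS] by (intro Q'(9) Q'(6)) (auto simp: polys_with_coeffs_def)
        then have "coeff (q * h) d + coeff (smult (?c ^ N) g - q * h) d \<in> Q"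
          using q(2) by (intro Q'(4)) (auto simp: polys_with_coeffs_def)
        then have "?c ^ N * ?a \<in> Q" by simp
        then show False using Q'(7)[OF S'(7)[OF c] a] powQ[OF c h(2)] g(2) by blast
      qed
      from least[OF singletonI this] obtain k where
        k: "coeff q k \<notin> Q" "\<And>i. i > k \<Longrightarrow> coeff q i \<in> Q" by blast
      have "\<not> k < d"
      proof
        assume "k < d"
        then have "q \<in> ?QX" using gmin[OF qP] k(2) by auto
        then show False using \<open>q \<notin> ?QX\<close> by blast
      qed
      have "coeff (q * h) (k + e) = coeff q k * coeff h e
          + (\<Sum>i\<in>{..k + e} - {k}. coeff q i * coeff h (k + e - i))"
        unfolding coeff_mult by (subst sum.remove[of _ k]) auto
      moreover have "(\<Sum>i\<in>{..k + e} - {k}. coeff q i * coeff h (k + e - i)) \<in> Q"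
      proof (rule Q'(9))
        fix i assume "i \<in> {..k + e} - {k}"
        then consider "i > k" | "k + e - i > e" by fastforce
        then show "coeff q i * coeff h (k + e - i) \<in> Q"
          using coeffS[OF hS] coeffS[OF q(1)] k(2) h(3) Q'(5,6) by cases auto
      qed
      moreover have "coeff (q * h) (k + e) \<in> Q"
      proof -
        have "coeff (q * h) (k + e)
            = ?c ^ N * coeff g (k + e) - coeff (smult (?c ^ N) g - q * h) (k + e)" by simp
        also have "\<dots> \<in> Q" using \<open>\<not> k < d\<close> \<open>e \<noteq> 0\<close> g(3) q(2) S'(7)[OF c]
          by (intro Q'(8) Q'(5)) (auto simp: polys_with_coeffs_def)
        finally show ?thesis .
      qed
      ultimately have "coeff q k * coeff h e \<in> Q" using Q'(8) by (metis add_diff_cancel_right')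
      then show False using Q'(7)[OF coeffS[OF q(1)] c] k(1) h(2) by blast
    qed
    have "h - [:?c:] \<in> J" using const[of h] h(3) QX PJ unfolding e by blast
    then have "h + (- 1) * (h - [:?c:]) \<in> J" using SX(2,5) by (intro Jadd[OF h(1)] Jmult) auto
    then have "[:?c:] \<in> J" by simp
    then obtain u w where u: "u \<in> ?SX" "w \<in> P" "[:?c:] = u * f + w" by (auto simp: J_def)
    have "\<exists>x. (\<forall>p\<in>P. poly (map_poly \<phi> p) x = 0) \<and> poly (map_poly \<phi> f) x \<noteq> 0"
      if \<phi>: "comm_ring_hom \<phi>" "\<forall>c\<in>S. [:c:] \<in> P \<longrightarrow> \<phi> c = 0" "\<phi> (?a * ?c) \<noteq> 0" for \<phi> :: "'a \<Rightarrow> 'l"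
    proof -
      interpret comm_ring_hom \<phi> by fact
      interpret mp: map_poly_comm_ring_hom \<phi> ..
      have ac: "\<phi> ?a \<noteq> 0" "\<phi> ?c \<noteq> 0" using \<phi>(3) by (auto simp: hom_distribs)
      have "d \<le> degree (map_poly \<phi> g)" using ac by (intro le_degree) simp
      then obtain x where x: "poly (map_poly \<phi> g) x = 0"
        using d alg_closed_imp_poly_has_root[of "map_poly \<phi> g"] by auto
      have van: "poly (map_poly \<phi> p) x = 0" if "p \<in> P" for p
      proof -
        obtain N q where q: "smult (?a ^ N) p - q * g \<in> ?QX" using divP[OF \<open>p \<in> P\<close>] by blast
        have "map_poly \<phi> (smult (?a ^ N) p - q * g) = 0"
          using hom0[OF \<phi>(1) _ q] \<phi>(2) by (auto simp: Q_def)
        then have "smult (\<phi> ?a ^ N) (map_poly \<phi> p) = map_poly \<phi> q * map_poly \<phi> g"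
          by (simp add: hom_distribs)
        then have "poly (smult (\<phi> ?a ^ N) (map_poly \<phi> p)) x = poly (map_poly \<phi> q * map_poly \<phi> g) x"
          by simp
        then show ?thesis using x ac by simp
      qed
      have "map_poly \<phi> [:?c:] = map_poly \<phi> u * map_poly \<phi> f + map_poly \<phi> w"
        unfolding u(3) by (simp add: hom_distribs)
      then have "poly (map_poly \<phi> [:?c:]) x = poly (map_poly \<phi> u * map_poly \<phi> f + map_poly \<phi> w) x"
        by simp
      moreover have "map_poly \<phi> [:?c:] = [:\<phi> ?c:]"
        by (rule poly_eqI) (simp add: coeff_pCons split: nat.split)
      ultimately have "poly (map_poly \<phi> f) x \<noteq> 0" using van[OF u(2)] ac by auto
      then show ?thesis using van by blast
    qed
    moreover have "[:?a * ?c:] \<notin> P"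
      using Q'(7)[OF a c] g(2) h(2) S'(4)[OF a c] by (auto simp: Q_def)
    ultimately show ?thesis using S'(4)[OF a c] by blast
  qed
qed

section \<open>Polynomials in several indeterminates\<close>

lemma mpoly_carrier_iff: "p \<in> carrier (mpoly_ring V) \<longleftrightarrow> (\<forall>t\<in>Poly_Mapping.keys p. Poly_Mapping.keys t \<subseteq> V)"
  by (simp add: mpoly_ring_def)

lemma mpoly_ring_simps [simp]:
  "x \<otimes>\<^bsub>mpoly_ring V\<^esub> y = x * y" "x \<oplus>\<^bsub>mpoly_ring V\<^esub> y = x + y"
  "\<one>\<^bsub>mpoly_ring V\<^esub> = 1" "\<zero>\<^bsub>mpoly_ring V\<^esub> = 0"
  by (simp_all add: mpoly_ring_def)

lemma subring_mpoly_ring: "subring_of (carrier (mpoly_ring V :: ('v, 'a::comm_ring_1) mpoly ring))"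
proof -
  interpret cring "mpoly_ring V :: ('v, 'a) mpoly ring" by (rule cring_mpoly_ring)
  have "- p \<in> carrier (mpoly_ring V)" if "p \<in> carrier (mpoly_ring V)" for p :: "('v, 'a) mpoly"
    using that by (simp add: mpoly_carrier_iff in_keys_iff)
  then show ?thesis
    using zero_closed one_closed a_closed m_closed by (simp add: subring_of_def)
qed

lemma monomial_in_mpoly_ring [intro]:
  "Poly_Mapping.keys t \<subseteq> V \<Longrightarrow> monomial c t \<in> carrier (mpoly_ring V)"
  by (auto simp: mpoly_carrier_iff monomial_def split: if_splits)

lemma mpoly_idealI:
  fixes N :: "('v, 'a::comm_ring_1) mpoly set"
  assumes N: "N \<subseteq> carrier (mpoly_ring V)" "0 \<in> N" "\<And>p q. p \<in> N \<Longrightarrow> q \<in> N \<Longrightarrow> p + q \<in> N"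
    and mult: "\<And>p q. p \<in> carrier (mpoly_ring V) \<Longrightarrow> q \<in> N \<Longrightarrow> p * q \<in> N"
  shows "ideal N (mpoly_ring V)"
proof -
  interpret cring "mpoly_ring V :: ('v, 'a) mpoly ring" by (rule cring_mpoly_ring)
  have S: "subring_of (carrier (mpoly_ring V) :: ('v, 'a) mpoly set)" by (rule subring_mpoly_ring)
  note S = subring_ofD[OF S]
  show ?thesis
  proof (rule idealI)
    show "subgroup N (add_monoid (mpoly_ring V))"
    proof (rule add.subgroupI)
      fix a assume a: "a \<in> N"
      have "\<ominus>\<^bsub>mpoly_ring V\<^esub> a = - a"
        using a N(1) S(5)[of a] by (intro minus_equality) auto
      moreover have "- 1 * a \<in> N" using a S(2,5) by (intro mult) auto
      ultimately show "\<ominus>\<^bsub>mpoly_ring V\<^esub> a \<in> N" by simp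
    qed (use N in auto)
    show "x \<otimes>\<^bsub>mpoly_ring V\<^esub> a \<in> N" if "a \<in> N" "x \<in> carrier (mpoly_ring V)" for a x
      using that mult by simp
    then show "a \<otimes>\<^bsub>mpoly_ring V\<^esub> x \<in> N" if "a \<in> N" "x \<in> carrier (mpoly_ring V)" for a x
      using that by (simp add: mult.commute)
  qed (rule ring_axioms)
qed

lemma poly_mapping_eq_sum_single:
  "p = (\<Sum>t\<in>Poly_Mapping.keys p. Poly_Mapping.single t (Poly_Mapping.lookup p t))"
  by (rule poly_mapping_eqI) (auto simp: lookup_sum lookup_single when_def sum.delta in_keys_iff)

lemma poly_mapping_additive_induct:
  fixes p :: "'t \<Rightarrow>\<^sub>0 'a::comm_monoid_add"
  assumes "P 0" "\<And>p q. P p \<Longrightarrow> P q \<Longrightarrow> P (p + q)"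
    "\<And>t. t \<in> Poly_Mapping.keys p \<Longrightarrow> P (Poly_Mapping.single t (Poly_Mapping.lookup p t))"
  shows "P p"
proof -
  have "P (\<Sum>t\<in>F. Poly_Mapping.single t (Poly_Mapping.lookup p t))"
    if "finite F" "F \<subseteq> Poly_Mapping.keys p" for F
    using that assms by (induction F) auto
  from this[of "Poly_Mapping.keys p"] show ?thesis
    using poly_mapping_eq_sum_single[of p] by simp
qed

text \<open>
  Both evaluation and the coordinate vectors below are additive extensions of a function on terms;
  rewriting the sum over the keys to a common finite superset makes the additivity visible.
\<close>

lemma sum_keys_superset:
  assumes "h 0 = 0" "finite F" "Poly_Mapping.keys p \<subseteq> F"
  shows "(\<Sum>t\<in>Poly_Mapping.keys p. h (Poly_Mapping.lookup p t) * g t)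
     = (\<Sum>t\<in>F. h (Poly_Mapping.lookup p t) * (g t :: 'b::comm_ring_1))"
  using assms by (intro sum.mono_neutral_left) (auto simp: in_keys_iff)

lemma sum_keys_add:
  fixes g :: "'t \<Rightarrow> 'b::comm_ring_1" and h :: "'a::ab_group_add \<Rightarrow> 'b"
  assumes h: "\<And>a b. h (a + b) = h a + h b"
  shows "(\<Sum>t\<in>Poly_Mapping.keys (p + q). h (Poly_Mapping.lookup (p + q) t) * g t)
     = (\<Sum>t\<in>Poly_Mapping.keys p. h (Poly_Mapping.lookup p t) * g t)
     + (\<Sum>t\<in>Poly_Mapping.keys q. h (Poly_Mapping.lookup q t) * g t)"
proof -
  have 0: "h 0 = 0" using h[of 0 0] by simp
  let ?F = "Poly_Mapping.keys p \<union> Poly_Mapping.keys q"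
  have F: "(\<Sum>t\<in>Poly_Mapping.keys u. h (Poly_Mapping.lookup u t) * g t)
      = (\<Sum>t\<in>?F. h (Poly_Mapping.lookup u t) * g t)" if "Poly_Mapping.keys u \<subseteq> ?F" for u
    by (rule sum_keys_superset[where h=h, OF 0 _ that]) simp
  show ?thesis
    using F[of p] F[of q] F[OF Poly_Mapping.keys_add]
    by (simp add: lookup_add h distrib_right sum.distrib)
qed

lemma mpoly_eval_add:
  assumes "\<And>a b. h (a + b) = h a + h b"
  shows "mpoly_eval h \<gamma> (p + q) = mpoly_eval h \<gamma> p + mpoly_eval h \<gamma> q"
  unfolding mpoly_eval_def by (rule sum_keys_add) (rule assms)

lemma mpoly_eval_single:
  "h 0 = 0 \<Longrightarrow> mpoly_eval h \<gamma> (Poly_Mapping.single t c)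
     = h c * (\<Prod>v\<in>Poly_Mapping.keys t. \<gamma> v ^ Poly_Mapping.lookup t v)"
  by (auto simp: mpoly_eval_def)

lemma power_product_add:
  fixes \<gamma> :: "'v \<Rightarrow> 'b::comm_ring_1"
  shows "(\<Prod>v\<in>Poly_Mapping.keys (s + t). \<gamma> v ^ Poly_Mapping.lookup (s + t) v)
     = (\<Prod>v\<in>Poly_Mapping.keys s. \<gamma> v ^ Poly_Mapping.lookup s v)
     * (\<Prod>v\<in>Poly_Mapping.keys t. \<gamma> v ^ Poly_Mapping.lookup t v)"
proof -
  let ?F = "Poly_Mapping.keys s \<union> Poly_Mapping.keys t"
  have *: "(\<Prod>v\<in>Poly_Mapping.keys u. \<gamma> v ^ Poly_Mapping.lookup u v) = (\<Prod>v\<in>?F. \<gamma> v ^ Poly_Mapping.lookup u v)"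
    if "Poly_Mapping.keys u \<subseteq> ?F" for u
    using that by (intro prod.mono_neutral_left) (auto simp: in_keys_iff)
  show ?thesis
    using *[of s] *[of t] *[of "s + t"] Poly_Mapping.keys_add[of s t]
    by (simp add: lookup_add power_add prod.distrib)
qed

lemma comm_ring_hom_mpoly_eval:
  assumes "comm_ring_hom h"
  shows "comm_ring_hom (mpoly_eval h \<gamma>)"
proof -
  interpret h: comm_ring_hom h by fact
  let ?e = "mpoly_eval h \<gamma>"
  have add: "?e (p + q) = ?e p + ?e q" for p q by (rule mpoly_eval_add) (rule h.hom_add)
  have 0: "?e 0 = 0" by (simp add: mpoly_eval_def)
  have "?e (p * q) = ?e p * ?e q" for p q
  proof (induction p rule: poly_mapping_additive_induct)
    case (3 s)
    show ?case
    proof (induction q rule: poly_mapping_additive_induct)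
      case (3 t)
      show ?case by (simp add: mult_single mpoly_eval_single power_product_add h.hom_mult mult_ac)
    qed (simp_all add: 0 add distrib_left)
  qed (simp_all add: 0 add distrib_right)
  moreover have "?e 1 = 1"
    using mpoly_eval_single[of h \<gamma> 0 1] by (simp add: single_one)
  ultimately show ?thesis by unfold_locales (use 0 add in auto)
qed

lemma comm_ring_hom_eval_at: "comm_ring_hom (eval_at \<Gamma> :: 'k::field cpoly \<Rightarrow> 'k alg_closure)"
  unfolding eval_at_def[abs_def] by (rule comm_ring_hom_mpoly_eval) (unfold_locales, auto)

lemma mpoly_eval_cong:
  assumes "p \<in> carrier (mpoly_ring V)" "\<And>v. v \<in> V \<Longrightarrow> \<gamma> v = \<gamma>' v"
  shows "mpoly_eval h \<gamma> p = mpoly_eval h \<gamma>' p"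
proof -
  have "(\<Prod>v\<in>Poly_Mapping.keys t. \<gamma> v ^ Poly_Mapping.lookup t v)
      = (\<Prod>v\<in>Poly_Mapping.keys t. \<gamma>' v ^ Poly_Mapping.lookup t v)" if "t \<in> Poly_Mapping.keys p" for t
  proof (rule prod.cong)
    fix v assume "v \<in> Poly_Mapping.keys t"
    then have "v \<in> V" using assms(1) that by (auto simp: mpoly_carrier_iff)
    then show "\<gamma> v ^ Poly_Mapping.lookup t v = \<gamma>' v ^ Poly_Mapping.lookup t v"
      by (simp add: assms(2))
  qed simp
  then show ?thesis unfolding mpoly_eval_def by (intro sum.cong) auto
qed

section \<open>Nullstellensatz\<close>

lemma monomial_xvar_power:
  "monomial 1 (xvar v) ^ k = (monomial 1 (Poly_Mapping.single v k) :: ('v, 'a::comm_ring_1) mpoly)"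
proof (induction k)
  case 0
  show ?case by (simp add: monomial_def)
next
  case (Suc k)
  then show ?case by (simp add: monomial_def xvar_def mult_single flip: single_add)
qed

text \<open>
  Primes and evaluations are pulled back along $q \mapsto q(x_v)$ from $K[W \cup \{v\}]$ to $K[W][X]$;
  this is the surjectivity of that map.
\<close>

lemma mpoly_as_univariate:
  assumes "p \<in> carrier (mpoly_ring (insert v W) :: ('v, 'a::comm_ring_1) mpoly ring)"
  shows "\<exists>q\<in>polys_with_coeffs (carrier (mpoly_ring W)). p = poly q (monomial 1 (xvar v))"
    (is "\<exists>q\<in>?SX. p = poly q ?X")
proof (rule poly_mapping_additive_induct[of _ p])
  have "subring_of (carrier (mpoly_ring W) :: ('v, 'a) mpoly set)" by (rule subring_mpoly_ring)
  note SX = subring_ofD[OF subring_polys_with_coeffs[OF this]]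
  show "\<exists>q\<in>?SX. 0 = poly q ?X" using SX(1) by (intro bexI[of _ 0]) auto
  show "\<exists>q\<in>?SX. p1 + p2 = poly q ?X"
    if "\<exists>q\<in>?SX. p1 = poly q ?X" "\<exists>q\<in>?SX. p2 = poly q ?X" for p1 p2
  proof -
    from that obtain q1 q2 where "q1 \<in> ?SX" "q2 \<in> ?SX" "p1 = poly q1 ?X" "p2 = poly q2 ?X" by blast
    then show ?thesis using SX(3) by (intro bexI[of _ "q1 + q2"]) auto
  qed
  fix t assume "t \<in> Poly_Mapping.keys p"
  then have t: "Poly_Mapping.keys t \<subseteq> insert v W" using assms by (auto simp: mpoly_carrier_iff)
  define c where "c = Poly_Mapping.lookup p t"
  define k where "k = Poly_Mapping.lookup t v"
  define t' where "t' = t - Poly_Mapping.single v k"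
  have tt': "t = t' + Poly_Mapping.single v k"
    unfolding t'_def k_def
    by (rule poly_mapping_eqI) (auto simp: lookup_add lookup_single minus_poly_mapping.rep_eq when_def)
  have "Poly_Mapping.keys t' \<subseteq> W"
  proof
    fix w assume "w \<in> Poly_Mapping.keys t'"
    then have "Poly_Mapping.lookup t' w \<noteq> 0" by (simp add: in_keys_iff)
    then have "Poly_Mapping.lookup t w \<noteq> 0" "w \<noteq> v"
      by (auto simp: t'_def k_def minus_poly_mapping.rep_eq lookup_single when_def split: if_splits)
    then show "w \<in> W" using t by (metis in_keys_iff insertE subsetD)
  qed
  then have "monomial c t' \<in> carrier (mpoly_ring W)" by (rule monomial_in_mpoly_ring)
  moreover have "poly (monom (monomial c t') k) ?X = Poly_Mapping.single t c"
    unfolding poly_monom monomial_xvar_power by (simp add: monomial_def mult_single flip: tt')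
  ultimately show "\<exists>q\<in>?SX. Poly_Mapping.single t (Poly_Mapping.lookup p t) = poly q ?X"
    using monom_in_polys_with_coeffs[OF subring_mpoly_ring] unfolding c_def by metis
qed

text \<open>
  In the induction step \<open>prime_extension\<close>, applied to $K[W]$ and the preimage of $P$ in $K[W][X]$,
  yields a polynomial \<open>b\<close> over the smaller set of indeterminates. The induction hypothesis gives a
  zero of $P \cap K[W]$ at which \<open>b\<close> does not vanish, and evaluation there extends by a value for the
  new indeterminate.
\<close>

lemma nullstellensatz:
  fixes h :: "'a::field \<Rightarrow> 'l::alg_closed_field" and P :: "('v, 'a) mpoly set"
  assumes h: "comm_ring_hom h" and "finite V"
    and "prime_of (carrier (mpoly_ring V)) P" "f \<in> carrier (mpoly_ring V)" "f \<notin> P"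
  shows "\<exists>\<gamma>. (\<forall>p\<in>P. mpoly_eval h \<gamma> p = 0) \<and> mpoly_eval h \<gamma> f \<noteq> 0"
  using assms(2-)
proof (induction V arbitrary: P f rule: finite_induct)
  case empty
  have K: "subring_of (carrier (mpoly_ring {}) :: ('v, 'a) mpoly set)" by (rule subring_mpoly_ring)
  note P = prime_ofD[OF K empty.prems(1)]
  interpret h: comm_ring_hom h by fact
  have const: "\<exists>c. p = Poly_Mapping.single 0 c" if "p \<in> carrier (mpoly_ring {})" for p :: "('v, 'a) mpoly"
  proof (intro exI poly_mapping_eqI)
    fix t
    show "Poly_Mapping.lookup p t = Poly_Mapping.lookup (Poly_Mapping.single 0 (Poly_Mapping.lookup p 0)) t"
      using that by (cases "t = 0") (auto simp: mpoly_carrier_iff lookup_single in_keys_iff when_def)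
  qed
  have unit: "p \<notin> P" if p: "p = Poly_Mapping.single 0 c" "c \<noteq> 0" for p c
  proof
    assume "p \<in> P"
    have "Poly_Mapping.single 0 (inverse c) * p \<in> P"
      using monomial_in_mpoly_ring[of 0 "{}" "inverse c"] \<open>p \<in> P\<close> by (intro P(5)) (auto simp: monomial_def)
    then show False using p P(3) by (simp add: mult_single flip: single_one)
  qed
  have "mpoly_eval h (\<lambda>_. 0) p = 0" if "p \<in> P" for p
    using const[of p] unit[of p] that P(1) by (force simp: mpoly_eval_def)
  moreover have "mpoly_eval h (\<lambda>_. 0) f \<noteq> 0"
  proof -
    obtain c where c: "f = Poly_Mapping.single 0 c" using const[OF empty.prems(2)] by blast
    then have "c \<noteq> 0" using P(2) empty.prems(3) by auto
    then have "h (c * inverse c) = 1" by (simp del: h.hom_mult)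
    then have "h c \<noteq> 0" unfolding h.hom_mult by auto
    then show ?thesis unfolding c by (simp add: mpoly_eval_single)
  qed
  ultimately show ?case by blast
next
  case (insert v W)
  let ?S = "carrier (mpoly_ring W) :: ('v, 'a) mpoly set"
  let ?S' = "carrier (mpoly_ring (insert v W)) :: ('v, 'a) mpoly set"
  let ?X = "monomial 1 (xvar v) :: ('v, 'a) mpoly"
  have S: "subring_of ?S" and S': "subring_of ?S'" by (rule subring_mpoly_ring)+
  note P = prime_ofD[OF S' insert.prems(1)] and S'D = subring_ofD[OF S']
  note SX = subring_ofD[OF subring_polys_with_coeffs[OF S]]
  have SS': "?S \<subseteq> ?S'" 
  proof
    fix p assume p: "p \<in> ?S"
    show "p \<in> ?S'" unfolding mpoly_carrier_iff
    proof
      fix t assume "t \<in> Poly_Mapping.keys p"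
      then have "Poly_Mapping.keys t \<subseteq> W" using p by (simp add: mpoly_carrier_iff)
      then show "Poly_Mapping.keys t \<subseteq> insert v W" by (rule subset_insertI2)
    qed
  qed
  have XS': "?X \<in> ?S'" by (rule monomial_in_mpoly_ring) (auto simp: xvar_def)
  have eval: "poly q ?X \<in> ?S'" if "q \<in> polys_with_coeffs ?S" for q
    unfolding poly_altdef
  proof (rule S'D(8))
    fix i
    have "coeff q i \<in> ?S'" using that SS' by (auto simp: polys_with_coeffs_def)
    then show "coeff q i * ?X ^ i \<in> ?S'" by (rule S'D(4)[OF _ S'D(7)[OF XS']])
  qed
  define PP where "PP = {q \<in> polys_with_coeffs ?S. poly q ?X \<in> P}"
  have PP: "prime_of (polys_with_coeffs ?S) PP"
    unfolding prime_of_def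
  proof (intro conjI ballI impI)
    show "PP \<subseteq> polys_with_coeffs ?S" "0 \<in> PP" "1 \<notin> PP" using SX(1) P(2,3) by (auto simp: PP_def)
    show "a + b \<in> PP" if "a \<in> PP" "b \<in> PP" for a b using that SX(3) P(4) by (auto simp: PP_def)
    show "a * b \<in> PP" if "a \<in> polys_with_coeffs ?S" "b \<in> PP" for a b
      using that SX(4) P(5)[OF eval] by (auto simp: PP_def)
    show "a \<in> PP \<or> b \<in> PP"
      if "a \<in> polys_with_coeffs ?S" "b \<in> polys_with_coeffs ?S" "a * b \<in> PP" for a b
      using that P(7)[OF eval eval] by (auto simp: PP_def)
  qed
  obtain qf where qf: "qf \<in> polys_with_coeffs ?S" "f = poly qf ?X"
    using mpoly_as_univariate[OF insert.prems(2)] by blast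
  have "qf \<notin> PP" using qf insert.prems(3) by (auto simp: PP_def)
  from prime_extension[OF S PP qf(1) this, where 'l='l] obtain b where b: "b \<in> ?S" "[:b:] \<notin> PP"
    and ext: "\<And>\<phi> :: ('v, 'a) mpoly \<Rightarrow> 'l. comm_ring_hom \<phi> \<Longrightarrow> (\<And>c. c \<in> ?S \<Longrightarrow> [:c:] \<in> PP \<Longrightarrow> \<phi> c = 0) \<Longrightarrow>
       \<phi> b \<noteq> 0 \<Longrightarrow> \<exists>x. (\<forall>p\<in>PP. poly (map_poly \<phi> p) x = 0) \<and> poly (map_poly \<phi> qf) x \<noteq> 0"
    by blast
  have C: "[:c:] \<in> polys_with_coeffs ?S" if "c \<in> ?S" for c
    using monom_in_polys_with_coeffs[OF S that, of 0] by (simp add: monom_0)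
  have PS: "prime_of ?S (P \<inter> ?S)"
    unfolding prime_of_def
  proof (intro conjI ballI impI)
    show "P \<inter> ?S \<subseteq> ?S" "0 \<in> P \<inter> ?S" "1 \<notin> P \<inter> ?S" using P(2,3) subring_ofD(1)[OF S] by auto
    show "a + b \<in> P \<inter> ?S" if "a \<in> P \<inter> ?S" "b \<in> P \<inter> ?S" for a b
      using that P(4) subring_ofD(3)[OF S] by blast
    show "a * b \<in> P \<inter> ?S" if "a \<in> ?S" "b \<in> P \<inter> ?S" for a b
      using that P(5) SS' subring_ofD(4)[OF S] by blast
    show "a \<in> P \<inter> ?S \<or> b \<in> P \<inter> ?S" if "a \<in> ?S" "b \<in> ?S" "a * b \<in> P \<inter> ?S" for a b
      using that P(7) SS' by blast
  qed
  have "b \<notin> P \<inter> ?S" using b C by (simp add: PP_def)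
  from insert.IH[OF PS b(1) this] obtain \<gamma> where
    \<gamma>: "\<And>p. p \<in> P \<inter> ?S \<Longrightarrow> mpoly_eval h \<gamma> p = 0" "mpoly_eval h \<gamma> b \<noteq> 0" by blast
  have "\<exists>x. (\<forall>p\<in>PP. poly (map_poly (mpoly_eval h \<gamma>) p) x = 0)
      \<and> poly (map_poly (mpoly_eval h \<gamma>) qf) x \<noteq> 0"
  proof (rule ext[OF comm_ring_hom_mpoly_eval[OF h]])
    show "mpoly_eval h \<gamma> c = 0" if "c \<in> ?S" "[:c:] \<in> PP" for c
      using that by (intro \<gamma>(1)) (simp add: PP_def)
  qed (rule \<gamma>(2))
  then obtain x where x: "\<And>p. p \<in> PP \<Longrightarrow> poly (map_poly (mpoly_eval h \<gamma>) p) x = 0"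
    "poly (map_poly (mpoly_eval h \<gamma>) qf) x \<noteq> 0" by blast
  define \<gamma>' where "\<gamma>' = \<gamma>(v := x)"
  have ev: "mpoly_eval h \<gamma>' (poly q ?X) = poly (map_poly (mpoly_eval h \<gamma>) q) x"
    if q: "q \<in> polys_with_coeffs ?S" for q
  proof -
    interpret h: comm_ring_hom h by fact
    interpret e: comm_ring_hom "mpoly_eval h \<gamma>" by (rule comm_ring_hom_mpoly_eval[OF h])
    interpret e': comm_ring_hom "mpoly_eval h \<gamma>'" by (rule comm_ring_hom_mpoly_eval[OF h])
    have "mpoly_eval h \<gamma>' ?X = x"
      by (simp add: monomial_def mpoly_eval_single xvar_def \<gamma>'_def)
    moreover have "map_poly (mpoly_eval h \<gamma>') q = map_poly (mpoly_eval h \<gamma>) q"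
    proof (rule poly_eqI)
      fix i
      have "mpoly_eval h \<gamma>' (coeff q i) = mpoly_eval h \<gamma> (coeff q i)"
        using q insert.hyps(2) by (intro mpoly_eval_cong[of _ W]) (auto simp: polys_with_coeffs_def \<gamma>'_def)
      then show "coeff (map_poly (mpoly_eval h \<gamma>') q) i = coeff (map_poly (mpoly_eval h \<gamma>) q) i" by simp
    qed
    ultimately show ?thesis using e'.poly_map_poly[of q ?X] by simp
  qed
  have "mpoly_eval h \<gamma>' p = 0" if "p \<in> P" for p
  proof -
    obtain q where q: "q \<in> polys_with_coeffs ?S" "p = poly q ?X"
      using mpoly_as_univariate[OF subsetD[OF P(1) \<open>p \<in> P\<close>]] by blast
    then have "q \<in> PP" using \<open>p \<in> P\<close> by (simp add: PP_def)
    then show ?thesis using ev[OF q(1)] x(1) q(2) by simp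
  qed
  moreover have "mpoly_eval h \<gamma>' f \<noteq> 0" using qf(2) ev[OF qf(1)] x(2) by simp
  ultimately show ?case by blast
qed

section \<open>The border basis at a rational point\<close>

lemma mat_power_commute:
  fixes A B :: "'a::comm_semiring_1 mat"
  assumes A: "A \<in> carrier_mat m m" and B: "B \<in> carrier_mat m m" and AB: "A * B = B * A"
  shows "A ^\<^sub>m k * B = B * A ^\<^sub>m k"
proof (induction k)
  case 0
  then show ?case using A B by simp
next
  case (Suc k)
  have Ak: "A ^\<^sub>m k \<in> carrier_mat m m" using A by simp
  have "A ^\<^sub>m Suc k * B = A ^\<^sub>m k * (A * B)" using assoc_mult_mat[OF Ak A B] by simp
  also have "\<dots> = (A ^\<^sub>m k * B) * A" unfolding AB using assoc_mult_mat[OF Ak B A] by simp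
  also have "\<dots> = B * A ^\<^sub>m Suc k" unfolding Suc using assoc_mult_mat[OF B Ak A] by simp
  finally show ?case .
qed

text \<open>
  The ordered product $A_{r_1}^{\alpha_{r_1}} \cdots A_{r_k}^{\alpha_{r_k}}$ over an arbitrary ring, so
  that the same lemmas serve the generic multiplication matrices and their values at a point.
\<close>

definition mat_term_prod :: "nat \<Rightarrow> ('v \<Rightarrow> 'a::comm_ring_1 mat) \<Rightarrow> 'v list \<Rightarrow> ('v \<Rightarrow>\<^sub>0 nat) \<Rightarrow> 'a mat" where
  "mat_term_prod m A rs t = foldr (\<lambda>r M. (A r ^\<^sub>m Poly_Mapping.lookup t r) * M) rs (1\<^sub>m m)"

lemma mat_term_prod_carrier:
  assumes "\<And>r. r \<in> set rs \<Longrightarrow> A r \<in> carrier_mat m m"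
  shows "mat_term_prod m A rs t \<in> carrier_mat m m"
  using assms
proof (induction rs)
  case (Cons r rs)
  have "A r ^\<^sub>m Poly_Mapping.lookup t r \<in> carrier_mat m m" using Cons.prems by simp
  moreover have "mat_term_prod m A rs t \<in> carrier_mat m m" using Cons by simp
  ultimately show ?case unfolding mat_term_prod_def by simp
qed (simp add: mat_term_prod_def)

text \<open>
  The factor for \<open>r\<close> absorbs the new matrix, which first has to pass the powers in front of it.
\<close>

lemma mat_term_prod_xvar:
  assumes A: "\<And>r. r \<in> set rs \<Longrightarrow> A r \<in> carrier_mat m m"
    and comm: "\<And>r s. r \<in> set rs \<Longrightarrow> s \<in> set rs \<Longrightarrow> A r * A s = A s * A r"
    and "distinct rs" "r \<in> set rs"
  shows "mat_term_prod m A rs (xvar r + t) = A r * mat_term_prod m A rs t"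
  using assms
proof (induction rs)
  case (Cons s rs)
  let ?F = "mat_term_prod m A rs"
  have F: "?F u \<in> carrier_mat m m" for u using Cons.prems by (intro mat_term_prod_carrier) auto
  have As: "A s \<in> carrier_mat m m" and Ar: "A r \<in> carrier_mat m m" using Cons.prems by auto
  have pow: "A s ^\<^sub>m k \<in> carrier_mat m m" for k using As by simp
  have step: "mat_term_prod m A (s # rs) u = A s ^\<^sub>m Poly_Mapping.lookup u s * ?F u" for u
    by (simp add: mat_term_prod_def)
  show ?case
  proof (cases "s = r")
    case True
    have "?F (xvar r + t) = ?F t" unfolding mat_term_prod_def
      using Cons.prems True by (intro foldr_cong) (auto simp: xvar_def lookup_add lookup_single when_def)
    moreover have "Poly_Mapping.lookup (xvar r + t) s = Suc (Poly_Mapping.lookup t s)"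
      using True by (simp add: xvar_def lookup_add)
    moreover have "A s ^\<^sub>m Suc k = A s * A s ^\<^sub>m k" for k
      using mat_power_commute[OF As As, of k] by simp
    ultimately show ?thesis unfolding step using True assoc_mult_mat[OF As pow F] by simp
  next
    case False
    have "?F (xvar r + t) = A r * ?F t" using Cons.IH Cons.prems False by auto
    moreover have "Poly_Mapping.lookup (xvar r + t) s = Poly_Mapping.lookup t s"
      using False by (simp add: xvar_def lookup_add lookup_single when_def)
    moreover have "A s ^\<^sub>m k * (A r * ?F t) = A r * (A s ^\<^sub>m k * ?F t)" for k
    proof -
      have "A s * A r = A r * A s" using Cons.prems by auto
      then have "A s ^\<^sub>m k * A r = A r * A s ^\<^sub>m k" by (rule mat_power_commute[OF As Ar])
      then show ?thesis using assoc_mult_mat[OF pow Ar F] assoc_mult_mat[OF Ar pow F] by metis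
    qed
    ultimately show ?thesis unfolding step by simp
  qed
qed simp

lemma tdeg_add: "tdeg (s + t) = tdeg s + tdeg t"
proof -
  have *: "tdeg u = (\<Sum>v\<in>Poly_Mapping.keys s \<union> Poly_Mapping.keys t. Poly_Mapping.lookup u v)"
    if "Poly_Mapping.keys u \<subseteq> Poly_Mapping.keys s \<union> Poly_Mapping.keys t" for u
    unfolding tdeg_def using that by (intro sum.mono_neutral_left) (auto simp: in_keys_iff)
  show ?thesis using *[of s] *[of t] *[of "s + t"] Poly_Mapping.keys_add[of s t]
    by (simp add: lookup_add sum.distrib)
qed

lemma tdeg_xvar [simp]: "tdeg (xvar v) = 1"
  by (simp add: tdeg_def xvar_def)

lemma tdeg_eq_0_iff [simp]: "tdeg t = 0 \<longleftrightarrow> t = 0"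
  unfolding tdeg_def by (auto simp: in_keys_iff intro: poly_mapping_eqI)

lemma keys_add_nat: "Poly_Mapping.keys (s + t :: 'v \<Rightarrow>\<^sub>0 nat) = Poly_Mapping.keys s \<union> Poly_Mapping.keys t"
  by (auto simp: in_keys_iff lookup_add)

lemma term_cases:
  assumes "t \<in> terms n"
  obtains "t = 0" | r t' where "r < n" "t' \<in> terms n" "t = xvar r + t'"
proof (cases "t = 0")
  case False
  then obtain r where r: "r \<in> Poly_Mapping.keys t" by (metis all_not_in_conv keys_eq_empty)
  define t' where "t' = t - xvar r"
  have t: "t = xvar r + t'"
    using r unfolding t'_def xvar_def
    by (intro poly_mapping_eqI) (auto simp: lookup_add lookup_single minus_poly_mapping.rep_eq when_def in_keys_iff)
  then have "t' \<in> terms n" using assms by (auto simp: terms_def keys_add_nat)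
  moreover have "r < n" using r assms by (auto simp: terms_def)
  ultimately show ?thesis using t that(2) by blast
qed (use that in blast)

lemma term_induct [consumes 1, case_names zero xvar]:
  assumes "t \<in> terms n" "P 0" "\<And>r t. r < n \<Longrightarrow> t \<in> terms n \<Longrightarrow> P t \<Longrightarrow> P (xvar r + t)"
  shows "P t"
  using assms(1)
proof (induction "tdeg t" arbitrary: t rule: less_induct)
  case less
  from less.prems show ?case
  proof (cases rule: term_cases)
    case (2 r t')
    then show ?thesis using less.hyps[of t'] assms(3) by (simp add: tdeg_add)
  qed (simp add: assms(2))
qed

lemma zero_in_terms [simp]: "0 \<in> terms n" by (simp add: terms_def)

lemma xvar_add_in_terms [simp]: "r < n \<Longrightarrow> xvar r + t \<in> terms n \<longleftrightarrow> t \<in> terms n"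
  by (auto simp: terms_def keys_add_nat xvar_def)

lemma affine_carrier_iff: "p \<in> carrier (affine_ring n) \<longleftrightarrow> Poly_Mapping.keys p \<subseteq> terms n"
  by (auto simp: mpoly_carrier_iff terms_def)

lemma order_ideal_zero: "order_ideal n T \<Longrightarrow> 0 \<in> T"
  unfolding order_ideal_def by (metis add_0 all_not_in_conv)

lemma affine_idealD:
  assumes "ideal I (affine_ring n :: (nat, 'a::field) mpoly ring)"
  shows "0 \<in> I" "\<And>p q. p \<in> I \<Longrightarrow> q \<in> I \<Longrightarrow> p + q \<in> I" "\<And>p q. p \<in> I \<Longrightarrow> q \<in> I \<Longrightarrow> p - q \<in> I"
    "\<And>p q. p \<in> carrier (affine_ring n) \<Longrightarrow> q \<in> I \<Longrightarrow> p * q \<in> I" "I \<subseteq> carrier (affine_ring n)"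
proof -
  interpret ideal I "affine_ring n :: (nat, 'a) mpoly ring" by fact
  show z: "0 \<in> I" and add: "\<And>p q. p \<in> I \<Longrightarrow> q \<in> I \<Longrightarrow> p + q \<in> I" and sub: "I \<subseteq> carrier (affine_ring n)"
    and mult: "\<And>p q. p \<in> carrier (affine_ring n) \<Longrightarrow> q \<in> I \<Longrightarrow> p * q \<in> I"
    using additive_subgroup.zero_closed[OF additive_subgroup_axioms]
      additive_subgroup.a_closed[OF additive_subgroup_axioms] I_l_closed a_subset by simp_all
  show "p - q \<in> I" if "p \<in> I" "q \<in> I" for p q
  proof -
    have "- 1 \<in> carrier (affine_ring n :: (nat, 'a) mpoly ring)" by (simp add: affine_carrier_iff)
    from mult[OF this that(2)] show ?thesis using that(1) add[of p "- q"] by simp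
  qed
qed

text \<open>
  At a rational point $\Gamma$ the order ideal is a basis of $R_\Gamma$, as is shown here by an explicit
  coordinate map, and linear independence of terms in $R_\Gamma$ is read off from a determinant.
\<close>

locale border_point =
  fixes n :: nat and ts bs :: "(nat \<Rightarrow>\<^sub>0 nat) list" and \<Gamma> :: "'k::field alg_closure mat"
  assumes ts: "ordered_order_ideal n ts"
    and bs: "distinct bs" "set bs = border n (set ts)"
    and \<Gamma>: "\<Gamma> \<in> rational_points n ts bs"
begin

abbreviation "\<mu> \<equiv> length ts"
abbreviation "ev \<equiv> eval_at \<Gamma>"
abbreviation "I \<equiv> point_ideal n ts bs \<Gamma>"
abbreviation "P \<equiv> affine_ring n :: (nat, 'k alg_closure) mpoly ring"

definition mult_mat :: "nat \<Rightarrow> 'k alg_closure mat" where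
  "mult_mat r = map_mat ev (generic_mult_mat ts bs r)"

sublocale ev: comm_ring_hom ev by (rule comm_ring_hom_eval_at)

lemma ts_order_ideal: "order_ideal n (set ts)" "distinct ts" "0 < \<mu>" "ts ! 0 = 0" "set ts \<subseteq> terms n"
proof -
  show oi: "order_ideal n (set ts)" and "distinct ts" using ts by (auto simp: ordered_order_ideal_def)
  then show pos: "0 < \<mu>" and "set ts \<subseteq> terms n" by (auto simp: order_ideal_def)
  obtain i where i: "i < \<mu>" "ts ! i = 0" using order_ideal_zero[OF oi] by (metis in_set_conv_nth)
  have "sorted (map tdeg ts)" using ts by (simp add: ordered_order_ideal_def)
  then have "tdeg (ts ! 0) \<le> tdeg (ts ! i)" using i pos sorted_nth_mono[of "map tdeg ts" 0 i] by simp
  then have "tdeg (ts ! 0) = 0" using i by (simp add: tdeg_def)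
  then show "ts ! 0 = 0" by simp
qed

lemma mult_mat_carrier: "mult_mat r \<in> carrier_mat \<mu> \<mu>"
  by (simp add: mult_mat_def generic_mult_mat_def)

text \<open>
  This is where $\Gamma$ being a point of the scheme enters: the entries of the generic commutators
  generate its ideal.
\<close>

lemma mult_mat_commute:
  assumes "r < n" "s < n"
  shows "mult_mat r * mult_mat s = mult_mat s * mult_mat r"
proof -
  let ?G = "generic_mult_mat ts bs :: nat \<Rightarrow> 'k cpoly mat"
  have G: "?G q \<in> carrier_mat \<mu> \<mu>" for q by (simp add: generic_mult_mat_def)
  have rs: "mult_mat r * mult_mat s = map_mat ev (?G r * ?G s)" "mult_mat s * mult_mat r = map_mat ev (?G s * ?G r)"
    unfolding mult_mat_def by (simp_all add: ev.mat_hom_mult[OF G G])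
  show ?thesis unfolding rs
  proof (rule eq_matI)
    fix i j assume ij: "i < dim_row (map_mat ev (?G s * ?G r))" "j < dim_col (map_mat ev (?G s * ?G r))"
    then have ij: "i < \<mu>" "j < \<mu>" using G[of s] G[of r] by auto
    have "(?G r * ?G s - ?G s * ?G r) $$ (i, j) \<in> border_scheme_ideal n ts bs"
      unfolding border_scheme_ideal_def genideal_def using assms ij by blast
    then have "ev ((?G r * ?G s - ?G s * ?G r) $$ (i, j)) = 0"
      using \<Gamma> by (auto simp: rational_points_def)
    then show "map_mat ev (?G r * ?G s) $$ (i, j) = map_mat ev (?G s * ?G r) $$ (i, j)"
      using ij G[of r] G[of s] by (auto simp: ev.hom_minus)
  qed (use G[of r] G[of s] in auto)
qed

text \<open>
  For terms $t'$ of an order ideal these vectors are the columns, at $\Gamma$, of the matrix $T'$ whose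
  determinant defines the locus.
\<close>

definition term_vec :: "(nat \<Rightarrow>\<^sub>0 nat) \<Rightarrow> 'k alg_closure vec" where
  "term_vec t = col (mat_term_prod \<mu> mult_mat [0..<n] t) 0"

lemma term_vec_carrier: "term_vec t \<in> carrier_vec \<mu>"
proof -
  have "mat_term_prod \<mu> mult_mat [0..<n] t \<in> carrier_mat \<mu> \<mu>"
    by (rule mat_term_prod_carrier) (rule mult_mat_carrier)
  then show ?thesis unfolding term_vec_def by (intro carrier_vecI) (simp add: carrier_matD(1))
qed

lemma term_vec_zero: "term_vec 0 = unit_vec \<mu> 0"
proof -
  have "mat_term_prod \<mu> mult_mat rs 0 = 1\<^sub>m \<mu>" for rs
  proof (induction rs)
    case (Cons r rs)
    have "mult_mat r ^\<^sub>m 0 = 1\<^sub>m \<mu>" using mult_mat_carrier[of r] by simp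
    then show ?case using Cons by (simp add: mat_term_prod_def)
  qed (simp add: mat_term_prod_def)
  then show ?thesis using ts_order_ideal(3) by (simp add: term_vec_def)
qed

lemma term_vec_xvar: "r < n \<Longrightarrow> term_vec (xvar r + t) = mult_mat r *\<^sub>v term_vec t"
proof -
  assume "r < n"
  then have "mat_term_prod \<mu> mult_mat [0..<n] (xvar r + t) = mult_mat r * mat_term_prod \<mu> mult_mat [0..<n] t"
    by (intro mat_term_prod_xvar mult_mat_commute mult_mat_carrier) auto
  moreover have "mat_term_prod \<mu> mult_mat [0..<n] t \<in> carrier_mat \<mu> \<mu>"
    by (rule mat_term_prod_carrier) (rule mult_mat_carrier)
  ultimately show ?thesis using mult_mat_carrier[of r] ts_order_ideal(3) unfolding term_vec_def by (simp add: col_mult2)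
qed

lemma term_mat_hom: "map_mat ev (term_mat n ts bs t) = mat_term_prod \<mu> mult_mat [0..<n] t"
  and term_mat_carrier: "(term_mat n ts bs t :: 'k cpoly mat) \<in> carrier_mat \<mu> \<mu>"
proof -
  let ?G = "generic_mult_mat ts bs :: nat \<Rightarrow> 'k cpoly mat"
  have G: "?G q \<in> carrier_mat \<mu> \<mu>" for q by (simp add: generic_mult_mat_def)
  have *: "mat_term_prod \<mu> ?G rs t \<in> carrier_mat \<mu> \<mu>" for rs by (rule mat_term_prod_carrier) (rule G)
  have "map_mat ev (mat_term_prod \<mu> ?G rs t) = mat_term_prod \<mu> mult_mat rs t" for rs
  proof (induction rs)
    case (Cons r rs)
    have pow: "?G r ^\<^sub>m k \<in> carrier_mat \<mu> \<mu>" for k using G by simp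
    have "map_mat ev (?G r ^\<^sub>m Poly_Mapping.lookup t r * mat_term_prod \<mu> ?G rs t)
       = mult_mat r ^\<^sub>m Poly_Mapping.lookup t r * mat_term_prod \<mu> mult_mat rs t"
      by (simp only: ev.mat_hom_mult[OF pow *] ev.mat_hom_pow[OF G] Cons mult_mat_def[of r])
    then show ?case by (simp add: mat_term_prod_def)
  qed (simp add: mat_term_prod_def ev.mat_hom_one)
  then show "map_mat ev (term_mat n ts bs t) = mat_term_prod \<mu> mult_mat [0..<n] t"
    "(term_mat n ts bs t :: 'k cpoly mat) \<in> carrier_mat \<mu> \<mu>"
    using * unfolding term_mat_def mat_term_prod_def by auto
qed

lemma the_border: "m < length bs \<Longrightarrow> (THE k. k < length bs \<and> bs ! k = bs ! m) = m"
  using bs(1) by (intro the_equality) (auto simp: nth_eq_iff_index_eq)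

lemma mult_mat_unit:
  assumes "j < \<mu>" "r < n"
  shows "xvar r + ts ! j = ts ! k \<Longrightarrow> k < \<mu> \<Longrightarrow> mult_mat r *\<^sub>v unit_vec \<mu> j = unit_vec \<mu> k"
    and "xvar r + ts ! j = bs ! m \<Longrightarrow> m < length bs \<Longrightarrow> mult_mat r *\<^sub>v unit_vec \<mu> j = col \<Gamma> m"
proof -
  have \<Gamma>c: "\<Gamma> \<in> carrier_mat \<mu> (length bs)" using \<Gamma> by (simp add: rational_points_def)
  have c: "mult_mat r *\<^sub>v unit_vec \<mu> j = col (mult_mat r) j" using mult_mat_carrier[of r] assms(1)
    by (intro eq_vecI) auto
  show "mult_mat r *\<^sub>v unit_vec \<mu> j = unit_vec \<mu> k" if k: "xvar r + ts ! j = ts ! k" "k < \<mu>"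
    unfolding c
  proof (rule eq_vecI)
    fix i assume "i < dim_vec (unit_vec \<mu> k :: 'k alg_closure vec)"
    then have "i < \<mu>" by simp
    then show "col (mult_mat r) j $ i = unit_vec \<mu> k $ i"
      using assms(1) k ts_order_ideal(2) by (auto simp: mult_mat_def generic_mult_mat_def Let_def nth_eq_iff_index_eq)
  qed (use mult_mat_carrier[of r] in auto)
  show "mult_mat r *\<^sub>v unit_vec \<mu> j = col \<Gamma> m" if m: "xvar r + ts ! j = bs ! m" "m < length bs"
    unfolding c
  proof (rule eq_vecI)
    fix i assume "i < dim_vec (col \<Gamma> m)"
    then have i: "i < \<mu>" using \<Gamma>c by simp
    have "bs ! m \<notin> set ts" using bs(2) m(2) by (auto simp: border_def dest: nth_mem)
    then have "col (mult_mat r) j $ i = ev (monomial 1 (xvar (i, m)))"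
      using assms(1) i m the_border[OF m(2)] by (simp add: mult_mat_def generic_mult_mat_def Let_def)
    also have "\<dots> = \<Gamma> $$ (i, m)"
      by (simp add: eval_at_def monomial_def mpoly_eval_single xvar_def)
    finally show "col (mult_mat r) j $ i = col \<Gamma> m $ i" using i m \<Gamma>c by simp
  qed (use mult_mat_carrier[of r] \<Gamma>c in auto)
qed

text \<open>
  A term $t_j = x_r t_k$ of the order ideal has the divisor $t_k$ in the order ideal, and the $r$-th
  matrix maps $e_k$ to $e_j$.
\<close>

lemma term_vec_order_ideal: "j < \<mu> \<Longrightarrow> term_vec (ts ! j) = unit_vec \<mu> j"
proof -
  have "\<forall>j<\<mu>. t = ts ! j \<longrightarrow> term_vec t = unit_vec \<mu> j" if "t \<in> terms n" for t
    using that
  proof (induction t rule: term_induct)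
    case zero
    then show ?case using ts_order_ideal term_vec_zero by (metis nth_eq_iff_index_eq)
  next
    case (xvar r t)
    show ?case
    proof (intro allI impI)
      fix j assume j: "j < \<mu>" "xvar r + t = ts ! j"
      then have "t \<in> set ts" using ts_order_ideal(1) unfolding order_ideal_def by (metis add.commute nth_mem)
      then obtain k where k: "k < \<mu>" "t = ts ! k" by (metis in_set_conv_nth)
      then have "term_vec t = unit_vec \<mu> k" using xvar(3) by blast
      then show "term_vec (xvar r + t) = unit_vec \<mu> j"
        using mult_mat_unit(1)[OF k(1) xvar(1), of j] j k(2) unfolding term_vec_xvar[OF xvar(1)] by simp
    qed
  qed
  then show "j < \<mu> \<Longrightarrow> term_vec (ts ! j) = unit_vec \<mu> j" using ts_order_ideal(5) nth_mem by blast
qed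

lemma border_nth:
  assumes "m < length bs"
  obtains r j where "r < n" "j < \<mu>" "bs ! m = xvar r + ts ! j"
proof -
  have "bs ! m \<in> border n (set ts)" using bs(2) assms nth_mem by blast
  then show ?thesis using that unfolding border_def by (auto simp: in_set_conv_nth)
qed

lemma term_vec_border: "m < length bs \<Longrightarrow> term_vec (bs ! m) = col \<Gamma> m"
proof -
  assume m: "m < length bs"
  obtain r j where "r < n" "j < \<mu>" "bs ! m = xvar r + ts ! j" using border_nth[OF m] .
  then show ?thesis using mult_mat_unit(2)[of j r m] m by (simp add: term_vec_xvar term_vec_order_ideal)
qed

text \<open>
  The linear extension of \<open>term_vec\<close>, $p \mapsto p(A_1, \ldots, A_n) e_1$. By \<open>in_I_iff\<close> and
  \<open>term_vec_order_ideal\<close> it gives the coordinates of the residue class of $p$ in the basis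
  $t_1, \ldots, t_\mu$ of $R_\Gamma$.
\<close>

definition coords :: "(nat, 'k alg_closure) mpoly \<Rightarrow> 'k alg_closure vec" where
  "coords p = vec \<mu> (\<lambda>i. \<Sum>t\<in>Poly_Mapping.keys p. Poly_Mapping.lookup p t * (term_vec t $ i))"

lemma coords_carrier [simp]: "coords p \<in> carrier_vec \<mu>" "dim_vec (coords p) = \<mu>" by (simp_all add: coords_def)

lemma coords_add: "coords (p + q) = coords p + coords q"
proof (rule eq_vecI)
  fix i assume "i < dim_vec (coords p + coords q)"
  then show "coords (p + q) $ i = (coords p + coords q) $ i"
    using sum_keys_add[of "\<lambda>c. c" p q "\<lambda>t. term_vec t $ i"] by (simp add: coords_def)
qed (simp add: coords_def)

lemma coords_0: "coords 0 = 0\<^sub>v \<mu>" by (auto simp: coords_def)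

lemma coords_single: "coords (Poly_Mapping.single t c) = c \<cdot>\<^sub>v term_vec t"
  using term_vec_carrier[of t] by (auto simp: coords_def)

lemma coords_minus: "coords (p - q) = coords p - coords q"
proof -
  have "coords p = coords (p - q) + coords q" using coords_add[of "p - q" q] by simp
  then show ?thesis by (auto intro!: eq_vecI)
qed

lemma coords_xvar: "r < n \<Longrightarrow> coords (Poly_Mapping.single (xvar r) 1 * p) = mult_mat r *\<^sub>v coords p"
proof (induction p rule: poly_mapping_additive_induct)
  case 1
  show ?case using mult_mat_carrier[of r] by (intro eq_vecI) (auto simp: coords_0)
next
  case (2 p q)
  then show ?case using mult_add_distrib_mat_vec[OF mult_mat_carrier[of r], of "coords p" "coords q"]
    by (simp add: distrib_left coords_add)
next
  case (3 t)
  then show ?case using mult_mat_vec[OF mult_mat_carrier[of r] term_vec_carrier[of t]]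
    by (simp add: mult_single coords_single term_vec_xvar)
qed

text \<open>
  The kernel is an ideal, since multiplication by $x_r$ acts on coordinates as a matrix.
\<close>

lemma coords_kernel_mult:
  assumes "q \<in> carrier P" "coords p = 0\<^sub>v \<mu>"
  shows "coords (q * p) = 0\<^sub>v \<mu>"
proof (rule poly_mapping_additive_induct[of _ q])
  show "coords (0 * p) = 0\<^sub>v \<mu>" by (simp add: coords_0)
  show "coords ((a + b) * p) = 0\<^sub>v \<mu>" if "coords (a * p) = 0\<^sub>v \<mu>" "coords (b * p) = 0\<^sub>v \<mu>" for a b
    using that by (simp add: distrib_right coords_add)
  fix t assume "t \<in> Poly_Mapping.keys q"
  then have "t \<in> terms n" using assms(1) by (auto simp: affine_carrier_iff)
  then show "coords (Poly_Mapping.single t c * p) = 0\<^sub>v \<mu>" for c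
  proof (induction t rule: term_induct)
    case zero
    have "coords (Poly_Mapping.single 0 c * p) = c \<cdot>\<^sub>v coords p"
    proof (induction p rule: poly_mapping_additive_induct)
      case 1
      show ?case by (intro eq_vecI) (auto simp: coords_0)
    next
      case (2 p q)
      then show ?case by (simp add: distrib_left coords_add smult_add_distrib_vec[OF coords_carrier(1) coords_carrier(1)])
    next
      case (3 t)
      show ?case by (simp add: mult_single coords_single smult_smult_assoc)
    qed
    then show ?case using assms(2) by (intro eq_vecI) auto
  next
    case (xvar r t)
    have "coords (Poly_Mapping.single (xvar r + t) c * p)
        = coords (Poly_Mapping.single (xvar r) 1 * (Poly_Mapping.single t c * p))"
      by (simp add: mult_single flip: mult.assoc)
    moreover have "mult_mat r *\<^sub>v 0\<^sub>v \<mu> = 0\<^sub>v \<mu>" using mult_mat_carrier[of r] by (intro eq_vecI) auto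
    ultimately show ?case using xvar by (simp add: coords_xvar)
  qed
qed

lemma generators_in_affine_ring:
  "{monomial 1 (bs ! j) - (\<Sum>i<\<mu>. monomial (\<Gamma> $$ (i, j)) (ts ! i)) | j. j < length bs} \<subseteq> carrier P"
proof -
  note S = subring_ofD[OF subring_mpoly_ring[of "{..<n}", where 'a="'k alg_closure"]]
  have "monomial c t \<in> carrier P" if "t \<in> terms n" for c t
    using that by (intro monomial_in_mpoly_ring) (auto simp: terms_def)
  moreover have "bs ! j \<in> terms n" if "j < length bs" for j
    using border_nth[OF that] ts_order_ideal(5) by (metis nth_mem subsetD xvar_add_in_terms)
  moreover have "ts ! j \<in> terms n" if "j < \<mu>" for j using ts_order_ideal(5) that nth_mem by blast
  ultimately show ?thesis by (auto intro!: S(6) S(8))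
qed

lemma I_ideal: "ideal I P"
proof -
  interpret cring P by (rule cring_mpoly_ring)
  show ?thesis unfolding point_ideal_def using generators_in_affine_ring by (rule genideal_ideal)
qed

text \<open>
  The coordinates of $b_j$ are the $j$-th column of $\Gamma$, so the kernel contains the generators of
  $I_\Gamma$.
\<close>

lemma I_subset_kernel: "p \<in> I \<Longrightarrow> coords p = 0\<^sub>v \<mu>"
proof -
  interpret cring P by (rule cring_mpoly_ring)
  let ?N = "{p \<in> carrier P. coords p = 0\<^sub>v \<mu>}"
  have "subring_of (carrier P)" by (rule subring_mpoly_ring)
  note S = subring_ofD[OF this]
  have "ideal ?N P"
    by (rule mpoly_idealI) (use S(1,3,4) in \<open>auto simp: coords_0 coords_add coords_kernel_mult\<close>)
  moreover have "{monomial 1 (bs ! j) - (\<Sum>i<\<mu>. monomial (\<Gamma> $$ (i, j)) (ts ! i)) | j. j < length bs} \<subseteq> ?N"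
  proof -
    have "coords (monomial 1 (bs ! j) - (\<Sum>i<\<mu>. monomial (\<Gamma> $$ (i, j)) (ts ! i))) = 0\<^sub>v \<mu>"
      if j: "j < length bs" for j
    proof -
      have \<Gamma>c: "\<Gamma> \<in> carrier_mat \<mu> (length bs)" using \<Gamma> by (simp add: rational_points_def)
      have "coords (\<Sum>i\<in>F. monomial (\<Gamma> $$ (i, j)) (ts ! i)) $ k
          = (\<Sum>i\<in>F. \<Gamma> $$ (i, j) * (if i = k then 1 else 0))"
        if "finite F" "F \<subseteq> {..<\<mu>}" "k < \<mu>" for k F
        using that(1,2)
      proof (induction F rule: finite_induct)
        case (insert i F)
        then show ?case using that(3)
          by (simp add: coords_add) (simp add: monomial_def coords_single term_vec_order_ideal)
      qed (simp add: coords_0 that(3))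
      then have "coords (\<Sum>i<\<mu>. monomial (\<Gamma> $$ (i, j)) (ts ! i)) = col \<Gamma> j"
        using j \<Gamma>c by (intro eq_vecI) (auto simp: if_distrib sum.delta cong: if_cong)
      then show ?thesis using j term_vec_border[OF j] \<Gamma>c
        by (simp add: coords_minus) (simp add: monomial_def coords_single)
    qed
    then show ?thesis using generators_in_affine_ring by blast
  qed
  ultimately have "I \<subseteq> ?N" unfolding point_ideal_def by (rule genideal_minimal)
  then show "p \<in> I \<Longrightarrow> coords p = 0\<^sub>v \<mu>" by blast
qed

text \<open>
  The span of the order ideal modulo $I_\Gamma$ contains 1 and is stable under each $x_r$, because
  $x_r t_j$ is in the order ideal or in the border, where a generator of $I_\Gamma$ rewrites it.
\<close>

lemma reduce:
  assumes "p \<in> carrier P"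
  shows "\<exists>q. Poly_Mapping.keys q \<subseteq> set ts \<and> p - q \<in> I"
proof -
  note I = affine_idealD[OF I_ideal]
  let ?R = "\<lambda>p. \<exists>q. Poly_Mapping.keys q \<subseteq> set ts \<and> p - q \<in> I"
  have add: "?R (p1 + p2)" if "?R p1" "?R p2" for p1 p2
  proof -
    from that obtain q1 q2 where q: "Poly_Mapping.keys q1 \<subseteq> set ts" "p1 - q1 \<in> I"
      "Poly_Mapping.keys q2 \<subseteq> set ts" "p2 - q2 \<in> I" by blast
    have "(p1 + p2) - (q1 + q2) = (p1 - q1) + (p2 - q2)" by simp
    also have "\<dots> \<in> I" using q I(2) by blast
    finally show ?thesis using q Poly_Mapping.keys_add[of q1 q2] by blast
  qed
  have zero: "?R 0" using I(1) by (intro exI[of _ 0]) simp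
  have self: "?R p" if "Poly_Mapping.keys p \<subseteq> set ts" for p
    using that I(1) by (intro exI[of _ p]) simp
  have trans: "?R p" if "?R q" "p - q \<in> I" for p q
  proof -
    from that(1) obtain q' where q': "Poly_Mapping.keys q' \<subseteq> set ts" "q - q' \<in> I" by blast
    have "p - q' = (p - q) + (q - q')" by simp
    also have "\<dots> \<in> I" using that(2) q'(2) I(2) by blast
    finally show ?thesis using q' by blast
  qed
  have const: "Poly_Mapping.single 0 c \<in> carrier P" for c by (auto simp: affine_carrier_iff)
  have border: "?R (Poly_Mapping.single (bs ! m) c)" if m: "m < length bs" for m c
  proof -
    let ?q = "(\<Sum>i<\<mu>. monomial (\<Gamma> $$ (i, m)) (ts ! i))"
    have "monomial 1 (bs ! m) - ?q \<in> I" unfolding point_ideal_def genideal_def using m by blast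
    then have "Poly_Mapping.single 0 c * (monomial 1 (bs ! m) - ?q) \<in> I" using I(4) const by blast
    then have "Poly_Mapping.single (bs ! m) c - Poly_Mapping.single 0 c * ?q \<in> I"
      by (simp add: monomial_def mult_single right_diff_distrib)
    moreover have "Poly_Mapping.keys (Poly_Mapping.single 0 c * ?q) \<subseteq> set ts"
    proof -
      have "Poly_Mapping.single 0 c * ?q = (\<Sum>i<\<mu>. Poly_Mapping.single (ts ! i) (c * \<Gamma> $$ (i, m)))"
        by (simp add: monomial_def mult_single sum_distrib_left)
      moreover have "Poly_Mapping.keys \<dots> \<subseteq> (\<Union>i<\<mu>. Poly_Mapping.keys (Poly_Mapping.single (ts ! i) (c * \<Gamma> $$ (i, m))))"
        by (rule keys_sum)
      moreover have "\<dots> \<subseteq> set ts" by auto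
      ultimately show ?thesis by simp
    qed
    ultimately show ?thesis by blast
  qed
  have xvar_ts: "?R (Poly_Mapping.single (xvar r) 1 * q)" if r: "r < n" and q: "Poly_Mapping.keys q \<subseteq> set ts" for r q
  proof (rule poly_mapping_additive_induct[of _ q])
    show "?R (Poly_Mapping.single (xvar r) 1 * 0)" using zero by simp
    show "?R (Poly_Mapping.single (xvar r) 1 * (a + b))"
      if "?R (Poly_Mapping.single (xvar r) 1 * a)" "?R (Poly_Mapping.single (xvar r) 1 * b)" for a b
      using add[OF that] by (simp add: distrib_left)
    fix t assume "t \<in> Poly_Mapping.keys q"
    then have t: "t \<in> set ts" using q by blast
    show "?R (Poly_Mapping.single (xvar r) 1 * Poly_Mapping.single t (Poly_Mapping.lookup q t))"
    proof (cases "xvar r + t \<in> set ts")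
      case True
      then show ?thesis by (intro self) (simp add: mult_single)
    next
      case False
      then have "xvar r + t \<in> set bs" using bs(2) r t by (auto simp: border_def)
      then obtain m where "m < length bs" "xvar r + t = bs ! m" by (metis in_set_conv_nth)
      then show ?thesis using border by (simp add: mult_single)
    qed
  qed
  show ?thesis
  proof (rule poly_mapping_additive_induct[of _ p])
    fix t assume "t \<in> Poly_Mapping.keys p"
    then have "t \<in> terms n" using assms by (auto simp: affine_carrier_iff)
    then show "?R (Poly_Mapping.single t c)" for c
    proof (induction t rule: term_induct)
      case zero
      show ?case using order_ideal_zero[OF ts_order_ideal(1)] by (intro self) auto
    next
      case (xvar r t)
      then obtain q where q: "Poly_Mapping.keys q \<subseteq> set ts" "Poly_Mapping.single t c - q \<in> I" by blast
      have "Poly_Mapping.single (xvar r) 1 \<in> carrier P" using xvar(1)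
        by (auto simp: affine_carrier_iff terms_def xvar_def)
      then have "Poly_Mapping.single (xvar r) 1 * (Poly_Mapping.single t c - q) \<in> I" using q(2) I(4) by blast
      then have "Poly_Mapping.single (xvar r + t) c - Poly_Mapping.single (xvar r) 1 * q \<in> I"
        by (simp add: right_diff_distrib mult_single)
      then show ?case using trans[OF xvar_ts[OF xvar(1) q(1)]] by blast
    qed
  qed (use zero add in auto)
qed

lemma kernel_order_ideal:
  assumes "Poly_Mapping.keys q \<subseteq> set ts" "coords q = 0\<^sub>v \<mu>"
  shows "q = 0"
proof (rule ccontr)
  assume "q \<noteq> 0"
  then obtain t where t: "t \<in> Poly_Mapping.keys q" by (metis all_not_in_conv keys_eq_empty)
  then obtain k where k: "k < \<mu>" "t = ts ! k" using assms(1) by (metis in_set_conv_nth subsetD)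
  have "coords q $ k = (\<Sum>s\<in>Poly_Mapping.keys q. Poly_Mapping.lookup q s * (if s = t then 1 else 0))"
    unfolding coords_def using k
  proof (simp, intro sum.cong refl)
    fix s assume "s \<in> Poly_Mapping.keys q"
    then obtain j where j: "j < \<mu>" "s = ts ! j" using assms(1) by (metis in_set_conv_nth subsetD)
    then show "Poly_Mapping.lookup q s * term_vec s $ k = Poly_Mapping.lookup q s * (if s = ts ! k then 1 else 0)"
      using k ts_order_ideal(2) by (auto simp: term_vec_order_ideal nth_eq_iff_index_eq)
  qed
  also have "\<dots> = Poly_Mapping.lookup q t"
    using t by (simp add: if_distrib sum.delta cong: if_cong)
  finally show False using assms(2) t k by (auto simp: in_keys_iff)
qed

text \<open>
  Modulo $I_\Gamma$, which lies in the kernel, every polynomial is a combination of the order ideal,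
  and the coordinate map is injective on such combinations.
\<close>

lemma in_I_iff: "p \<in> carrier P \<Longrightarrow> p \<in> I \<longleftrightarrow> coords p = 0\<^sub>v \<mu>"
proof
  assume p: "p \<in> carrier P" "coords p = 0\<^sub>v \<mu>"
  obtain q where q: "Poly_Mapping.keys q \<subseteq> set ts" "p - q \<in> I" using reduce[OF p(1)] by blast
  have "0\<^sub>v \<mu> = 0\<^sub>v \<mu> - coords q" using I_subset_kernel[OF q(2)] p(2) by (simp add: coords_minus)
  then have "coords q = 0\<^sub>v \<mu>" by (metis coords_0 coords_carrier(1) coords_minus diff_0 minus_zero_vec uminus_uminus_vec zero_minus_vec)
  then have "q = 0" using kernel_order_ideal q(1) by blast
  then show "p \<in> I" using q(2) by simp
qed (use I_subset_kernel in blast)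

text \<open>
  At $\Gamma$ the columns of the matrix are the coordinate vectors of the terms in \<open>us\<close>, so a linear
  relation between the columns is a polynomial with these terms in $I_\Gamma$.
\<close>

lemma det_dfb_mat_nonzero_iff:
  assumes us: "length us = \<mu>" "distinct us" "set us \<subseteq> terms n"
  shows "ev (det (dfb_mat n ts bs us)) \<noteq> 0 \<longleftrightarrow> (\<forall>p. Poly_Mapping.keys p \<subseteq> set us \<longrightarrow> p \<in> I \<longrightarrow> p = 0)"
proof -
  define B where "B = mat \<mu> \<mu> (\<lambda>(i, j). term_vec (us ! j) $ i)"
  have B: "B \<in> carrier_mat \<mu> \<mu>" by (simp add: B_def)
  have tm: "dim_row (term_mat n ts bs t :: 'k cpoly mat) = \<mu>" "dim_col (term_mat n ts bs t :: 'k cpoly mat) = \<mu>" for t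
    using term_mat_carrier[of t] by auto
  have "map_mat ev (dfb_mat n ts bs us) = B"
  proof (rule eq_matI)
    fix i j assume "i < dim_row B" "j < dim_col B"
    then have ij: "i < \<mu>" "j < \<mu>" by (auto simp: B_def)
    have "ev (term_mat n ts bs (us ! j) $$ (i, 0)) = map_mat ev (term_mat n ts bs (us ! j)) $$ (i, 0)"
      using ij ts_order_ideal(3) by (simp add: tm)
    also have "\<dots> = term_vec (us ! j) $ i" unfolding term_mat_hom term_vec_def
      using ij mat_term_prod_carrier[of "[0..<n]" mult_mat \<mu> "us ! j"] mult_mat_carrier by (subst index_col) auto
    finally show "map_mat ev (dfb_mat n ts bs us) $$ (i, j) = B $$ (i, j)"
      using ij us(1) ts_order_ideal(3) by (simp add: dfb_mat_def mat_of_cols_index B_def tm)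
  qed (use us(1) in \<open>auto simp: dfb_mat_def B_def\<close>)
  then have det: "ev (det (dfb_mat n ts bs us)) = det B" using ev.hom_det by metis
  define comb where "comb v = (\<Sum>j\<in>{..<\<mu>}. Poly_Mapping.single (us ! j) (v $ j))"
    for v :: "'k alg_closure vec"
  have mult: "B *\<^sub>v v = coords (comb v)" if v: "v \<in> carrier_vec \<mu>" for v
  proof (rule eq_vecI)
    fix i assume "i < dim_vec (coords (comb v))"
    then have i: "i < \<mu>" by simp
    have "coords (\<Sum>j\<in>F. Poly_Mapping.single (us ! j) (v $ j)) $ i = (\<Sum>j\<in>F. term_vec (us ! j) $ i * v $ j)"
      if "finite F" for F
      using that
    proof (induction F rule: finite_induct)
      case (insert j F)
      then show ?case using i term_vec_carrier[of "us ! j"] by (simp add: coords_add coords_single mult.commute)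
    qed (simp add: coords_0 i)
    then show "(B *\<^sub>v v) $ i = coords (comb v) $ i"
      using i v B by (simp add: scalar_prod_def B_def lessThan_atLeast0 comb_def)
  qed (use B in simp)
  have lookup: "Poly_Mapping.lookup (comb v) (us ! k) = v $ k"
    if "k < \<mu>" for v :: "'k alg_closure vec" and k
  proof -
    have "(\<Sum>j\<in>{..<\<mu>}. v $ j when us ! j = us ! k) = (\<Sum>j\<in>{..<\<mu>}. if j = k then v $ j else 0)"
      using us that by (intro sum.cong) (auto simp: when_def nth_eq_iff_index_eq)
    then show ?thesis using that by (simp add: comb_def lookup_sum lookup_single)
  qed
  have keys: "Poly_Mapping.keys (comb v) \<subseteq> set us" for v
    using keys_sum[of "\<lambda>j. Poly_Mapping.single (us ! j) (v $ j)" "{..<\<mu>}"] us(1)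
    unfolding comb_def by (fastforce split: if_splits)
  have carr: "p \<in> carrier P" if "Poly_Mapping.keys p \<subseteq> set us" for p
    using that us(3) by (auto simp: affine_carrier_iff)
  have "det B = 0 \<longleftrightarrow> (\<exists>v. v \<in> carrier_vec \<mu> \<and> v \<noteq> 0\<^sub>v \<mu> \<and> B *\<^sub>v v = 0\<^sub>v \<mu>)"
    by (rule det_0_iff_vec_prod_zero_field[OF B])
  also have "\<dots> \<longleftrightarrow> (\<exists>p. Poly_Mapping.keys p \<subseteq> set us \<and> p \<in> I \<and> p \<noteq> 0)"
  proof
    assume "\<exists>v. v \<in> carrier_vec \<mu> \<and> v \<noteq> 0\<^sub>v \<mu> \<and> B *\<^sub>v v = 0\<^sub>v \<mu>"
    then obtain v where v: "v \<in> carrier_vec \<mu>" "v \<noteq> 0\<^sub>v \<mu>" "B *\<^sub>v v = 0\<^sub>v \<mu>" by blast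
    let ?p = "comb v"
    have "?p \<in> I" using in_I_iff[OF carr[OF keys]] mult[OF v(1)] v(3) by simp
    moreover obtain k where "k < \<mu>" "v $ k \<noteq> 0" using v(1,2) by (metis carrier_vecD eq_vecI index_zero_vec)
    then have "?p \<noteq> 0" using lookup[of k v] by auto
    ultimately show "\<exists>p. Poly_Mapping.keys p \<subseteq> set us \<and> p \<in> I \<and> p \<noteq> 0" using keys by blast
  next
    assume "\<exists>p. Poly_Mapping.keys p \<subseteq> set us \<and> p \<in> I \<and> p \<noteq> 0"
    then obtain p where p: "Poly_Mapping.keys p \<subseteq> set us" "p \<in> I" "p \<noteq> 0" by blast
    define v where "v = vec \<mu> (\<lambda>j. Poly_Mapping.lookup p (us ! j))"
    have pv: "(comb v) = p" (is "?q = p")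
    proof (rule poly_mapping_eqI)
      fix t
      show "Poly_Mapping.lookup ?q t = Poly_Mapping.lookup p t"
      proof (cases "t \<in> set us")
        case True
        then obtain k where "k < \<mu>" "t = us ! k" using us(1) by (metis in_set_conv_nth)
        then show ?thesis using lookup by (simp add: v_def)
      next
        case False
        then have "t \<notin> Poly_Mapping.keys ?q" "t \<notin> Poly_Mapping.keys p" using keys p(1) by blast+
        then show ?thesis by (simp add: in_keys_iff)
      qed
    qed
    have "v \<in> carrier_vec \<mu>" by (simp add: v_def)
    moreover have "B *\<^sub>v v = 0\<^sub>v \<mu>" using mult[of v] pv I_subset_kernel[OF p(2)] by (simp add: v_def)
    moreover have "v \<noteq> 0\<^sub>v \<mu>"
    proof
      assume "v = 0\<^sub>v \<mu>"
      then have "?q = (\<Sum>j\<in>{..<\<mu>}. 0)" unfolding comb_def by (intro sum.cong) auto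
      then show False using pv p(3) by simp
    qed
    ultimately show "\<exists>v. v \<in> carrier_vec \<mu> \<and> v \<noteq> 0\<^sub>v \<mu> \<and> B *\<^sub>v v = 0\<^sub>v \<mu>" by blast
  qed
  finally show ?thesis unfolding det by blast
qed

end

section \<open>Bases of the affine coordinate ring\<close>

text \<open>
  Dimensions of subspaces of $P/I$ are computed on representatives: a family of terms is compared
  with $I$ by looking at polynomials supported in the family.
\<close>

locale proper_affine_ideal =
  fixes n :: nat and I :: "(nat, 'a::field) mpoly set"
  assumes ideal: "ideal I (affine_ring n)" and proper: "1 \<notin> I"
begin

abbreviation "P \<equiv> affine_ring n :: (nat, 'a) mpoly ring"
abbreviation "R \<equiv> coord_ring n I"
abbreviation "K \<equiv> scalars n I"

definition cls :: "(nat, 'a) mpoly \<Rightarrow> (nat, 'a) mpoly set" where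
  "cls p = I +>\<^bsub>P\<^esub> p"

definition independent_mod :: "(nat \<Rightarrow>\<^sub>0 nat) set \<Rightarrow> bool" where
  "independent_mod U \<longleftrightarrow> (\<forall>p. Poly_Mapping.keys p \<subseteq> U \<longrightarrow> p \<in> I \<longrightarrow> p = 0)"

text \<open>
  \<open>U\<close> is a set of terms in \<open>D\<close> whose residue classes form a basis of the image of the polynomials
  supported in \<open>D\<close>. With the terms of degree at most $i$ as \<open>D\<close> this image is $F_i$, with all terms it
  is the whole ring.
\<close>

definition basis_mod :: "(nat \<Rightarrow>\<^sub>0 nat) set \<Rightarrow> (nat \<Rightarrow>\<^sub>0 nat) set \<Rightarrow> bool" where
  "basis_mod D U \<longleftrightarrow> U \<subseteq> D \<and> independent_mod U \<and>
     (\<forall>p. Poly_Mapping.keys p \<subseteq> D \<longrightarrow> (\<exists>q. Poly_Mapping.keys q \<subseteq> U \<and> p - q \<in> I))"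

lemmas I = affine_idealD[OF ideal]

lemma cls_eq_iff: "cls p = cls q \<longleftrightarrow> p - q \<in> I"
proof -
  have cls: "cls p = {h + p | h. h \<in> I}" for p
    unfolding cls_def a_r_coset_def' by auto
  show ?thesis
  proof
    assume "cls p = cls q"
    moreover have "p \<in> cls p" using I(1) unfolding cls by force
    ultimately obtain h where "h \<in> I" "p = h + q" unfolding cls by blast
    then show "p - q \<in> I" by simp
  next
    have sub: "cls p \<subseteq> cls q" if "p - q \<in> I" for p q
    proof
      fix x assume "x \<in> cls p"
      then obtain h where h: "h \<in> I" "x = h + p" unfolding cls by blast
      then have "x = (h + (p - q)) + q" "h + (p - q) \<in> I" using I(2) that by auto
      then show "x \<in> cls q" unfolding cls by blast
    qed
    assume pq: "p - q \<in> I"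
    then have "q - p \<in> I" using I(3)[OF I(1) pq] by simp
    then show "cls p = cls q" using sub pq by blast
  qed
qed

lemma cls_hom: "ring_hom_ring P R cls"
  using ideal.rcos_ring_hom_ring[OF ideal] unfolding cls_def[abs_def] coord_ring_def .

lemma single_in_P: "t \<in> terms n \<Longrightarrow> Poly_Mapping.single t c \<in> carrier P"
  by (auto simp: affine_carrier_iff)

text \<open>
  The scalars are the image of the base field under a ring homomorphism to a nonzero ring.
\<close>

lemma subfield_scalars: "subfield K R"
proof -
  interpret cls: ring_hom_ring P R cls by (rule cls_hom)
  let ?F = "ring_of_type_algebra :: 'a ring"
  let ?h = "\<lambda>c. cls (monomial c 0)"
  interpret F: field ?F by (rule field_from_type_algebra)
  have F: "carrier ?F = UNIV" "\<one>\<^bsub>?F\<^esub> = 1" "x \<otimes>\<^bsub>?F\<^esub> y = x * y" "x \<oplus>\<^bsub>?F\<^esub> y = x + y" for x y :: 'a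
    by (simp_all add: ring_of_type_algebra_def)
  have mono: "monomial c 0 \<in> carrier P" for c :: 'a using single_in_P by (simp add: monomial_def)
  have "ring_hom_ring ?F R ?h"
  proof (rule ring_hom_ringI2)
    show "?h \<in> Ring.ring_hom ?F R"
    proof (rule ring_hom_memI)
      show "?h (x \<otimes>\<^bsub>?F\<^esub> y) = ?h x \<otimes>\<^bsub>R\<^esub> ?h y" for x y
        unfolding F cls.hom_mult[OF mono mono, symmetric] by (simp add: monomial_def mult_single)
      show "?h (x \<oplus>\<^bsub>?F\<^esub> y) = ?h x \<oplus>\<^bsub>R\<^esub> ?h y" for x y
        unfolding F cls.hom_add[OF mono mono, symmetric] by (simp add: monomial_def single_add)
      show "?h \<one>\<^bsub>?F\<^esub> = \<one>\<^bsub>R\<^esub>" unfolding F cls.hom_one[symmetric] by (simp add: monomial_def)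
    qed (use mono cls.hom_closed in blast)
  qed (simp_all add: F.ring_axioms cls.S.ring_axioms)
  then interpret h: ring_hom_ring ?F R ?h .
  have "\<one>\<^bsub>R\<^esub> \<noteq> \<zero>\<^bsub>R\<^esub>"
  proof
    assume "\<one>\<^bsub>R\<^esub> = \<zero>\<^bsub>R\<^esub>"
    then have "cls 1 = cls 0" using cls.hom_one cls.hom_zero by simp
    then show False using proper cls_eq_iff by simp
  qed
  then have "subfield (?h ` carrier ?F) R" by (rule h.img_is_subfield(2)[OF F.carrier_is_subfield])
  moreover have "?h ` carrier ?F = K" unfolding F(1) scalars_def cls_def by auto
  ultimately show ?thesis by simp
qed

definition residue_list :: "(nat \<Rightarrow>\<^sub>0 nat) list \<Rightarrow> (nat, 'a) mpoly set list" where
  "residue_list us = map (\<lambda>t. cls (monomial 1 t)) us"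

lemma residue_list_simps [simp]:
  "residue_list [] = []" "residue_list (u # us) = cls (monomial 1 u) # residue_list us"
  "set (residue_list us) = (\<lambda>t. cls (monomial 1 t)) ` set us" "length (residue_list us) = length us"
  by (simp_all add: residue_list_def)

lemma residue_list_carrier:
  assumes "set us \<subseteq> terms n"
  shows "set (residue_list us) \<subseteq> carrier R"
proof -
  interpret cls: ring_hom_ring P R cls by (rule cls_hom)
  show ?thesis
    using assms single_in_P cls.hom_closed by (auto simp: monomial_def)
qed

lemma Span_residue_list:
  assumes "set us \<subseteq> terms n"
  shows "ring.Span R K (residue_list us) = {cls p | p. Poly_Mapping.keys p \<subseteq> set us}"
proof -
  interpret cls: ring_hom_ring P R cls by (rule cls_hom)
  show ?thesis
    using assms
  proof (induction us)
    case Nil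
    have "\<zero>\<^bsub>R\<^esub> = cls 0" using cls.hom_zero by simp
    then show ?case by auto
  next
    case (Cons u us)
    have line: "x \<in> ring.Span R K (residue_list (u # us)) \<longleftrightarrow>
        (\<exists>k\<in>K. \<exists>v\<in>ring.Span R K (residue_list us). x = k \<otimes>\<^bsub>R\<^esub> cls (monomial 1 u) \<oplus>\<^bsub>R\<^esub> v)" for x
      using cls.S.line_extension_mem_iff by simp
    have step: "cls (monomial c 0) \<otimes>\<^bsub>R\<^esub> cls (monomial 1 u) \<oplus>\<^bsub>R\<^esub> cls p = cls (Poly_Mapping.single u c + p)"
      if "Poly_Mapping.keys p \<subseteq> set us" for c p
    proof -
      have c: "Poly_Mapping.single t c \<in> carrier P" if "t \<in> terms n" for t c
        using that by (rule single_in_P)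
      have p: "p \<in> carrier P" using that Cons.prems by (auto simp: affine_carrier_iff)
      have u: "u \<in> terms n" using Cons.prems by simp
      have "cls (Poly_Mapping.single u c + p) = cls (Poly_Mapping.single 0 c * Poly_Mapping.single u 1) \<oplus>\<^bsub>R\<^esub> cls p"
        using cls.hom_add[OF c[OF u] p] by (simp add: mult_single)
      then show ?thesis using cls.hom_mult[OF c[OF zero_in_terms, of c] c[OF u, of 1]]
        by (simp add: monomial_def)
    qed
    show ?case
    proof (intro equalityI subsetI)
      fix x assume "x \<in> ring.Span R K (residue_list (u # us))"
      then obtain k v where k: "k \<in> K" "v \<in> ring.Span R K (residue_list us)" "x = k \<otimes>\<^bsub>R\<^esub> cls (monomial 1 u) \<oplus>\<^bsub>R\<^esub> v"
        unfolding line by blast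
      then obtain c p where c: "k = cls (monomial c 0)" "v = cls p" "Poly_Mapping.keys p \<subseteq> set us"
        using Cons unfolding scalars_def cls_def by auto
      have "Poly_Mapping.keys (Poly_Mapping.single u c + p) \<subseteq> set (u # us)"
        using c(3) Poly_Mapping.keys_add[of "Poly_Mapping.single u c" p] by (auto split: if_splits)
      then show "x \<in> {cls p | p. Poly_Mapping.keys p \<subseteq> set (u # us)}" using k(3) c step by auto
    next
      fix x assume "x \<in> {cls p | p. Poly_Mapping.keys p \<subseteq> set (u # us)}"
      then obtain p where p: "x = cls p" "Poly_Mapping.keys p \<subseteq> set (u # us)" by blast
      define c where "c = (if u \<in> set us then 0 else Poly_Mapping.lookup p u)"
      define p' where "p' = p - Poly_Mapping.single u c"
      have p': "Poly_Mapping.keys p' \<subseteq> set us"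
      proof
        fix t assume t: "t \<in> Poly_Mapping.keys p'"
        show "t \<in> set us"
        proof (cases "t = u")
          case True
          then show ?thesis using t by (auto simp: p'_def c_def in_keys_iff lookup_minus split: if_splits)
        next
          case False
          then have "t \<in> Poly_Mapping.keys p" using t by (simp add: p'_def in_keys_iff lookup_minus lookup_single when_def)
          then show ?thesis using p(2) False by auto
        qed
      qed
      have "x = cls (monomial c 0) \<otimes>\<^bsub>R\<^esub> cls (monomial 1 u) \<oplus>\<^bsub>R\<^esub> cls p'"
        unfolding step[OF p'] p(1) by (simp add: p'_def)
      moreover have "cls p' \<in> ring.Span R K (residue_list us)" using Cons p' by auto
      moreover have "cls (monomial c 0) \<in> K" unfolding scalars_def cls_def by blast
      ultimately show "x \<in> ring.Span R K (residue_list (u # us))" unfolding line by blast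
    qed
  qed
qed

lemma independent_residue_list:
  assumes "set us \<subseteq> terms n" "distinct us" "independent_mod (set us)"
  shows "ring.independent R K (residue_list us)"
proof -
  interpret cls: ring_hom_ring P R cls by (rule cls_hom)
  show ?thesis
    using assms
  proof (induction us)
    case (Cons u us)
    have "cls (monomial 1 u) \<notin> ring.Span R K (residue_list us)"
    proof
      assume "cls (monomial 1 u) \<in> ring.Span R K (residue_list us)"
      then obtain p where p: "cls (monomial 1 u) = cls p" "Poly_Mapping.keys p \<subseteq> set us"
        using Span_residue_list[of us] Cons.prems(1) by auto
      then have "monomial 1 u - p \<in> I" by (simp add: cls_eq_iff)
      moreover have "Poly_Mapping.keys (monomial 1 u - p) \<subseteq> set (u # us)"
        using p(2) keys_diff[of "monomial 1 u" p] by (auto simp: monomial_def)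
      ultimately have "monomial 1 u - p = 0" using Cons.prems(3) unfolding independent_mod_def by blast
      then have "u \<in> Poly_Mapping.keys p" by (auto simp: monomial_def)
      then show False using p(2) Cons.prems(2) by auto
    qed
    moreover have "independent_mod (set us)" using Cons.prems(3) unfolding independent_mod_def by auto
    moreover have "cls (monomial 1 u) \<in> carrier R" using residue_list_carrier[of "[u]"] Cons.prems(1) by simp
    ultimately show ?case using Cons by (simp add: cls.S.independent.li_Cons)
  qed (simp add: cls.S.independent.li_Nil)
qed

definition span_of :: "(nat \<Rightarrow>\<^sub>0 nat) set \<Rightarrow> (nat, 'a) mpoly set set" where
  "span_of D = {cls p | p. Poly_Mapping.keys p \<subseteq> D}"

lemma dimension_basis:
  assumes "basis_mod D U" "D \<subseteq> terms n" "finite U"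
  shows "ring.dimension R (card U) K (span_of D)"
proof -
  interpret cls: ring_hom_ring P R cls by (rule cls_hom)
  obtain us where us: "set us = U" "distinct us" using finite_distinct_list[OF assms(3)] by blast
  have U: "U \<subseteq> terms n" "U \<subseteq> D" using assms by (auto simp: basis_mod_def)
  have "ring.independent R K (residue_list us)"
    using independent_residue_list us U assms(1) by (simp add: basis_mod_def)
  moreover have "ring.Span R K (residue_list us) = span_of D"
  proof -
    have "\<exists>q. cls p = cls q \<and> Poly_Mapping.keys q \<subseteq> U" if "Poly_Mapping.keys p \<subseteq> D" for p
      using that assms(1) by (auto simp: basis_mod_def cls_eq_iff)
    moreover have "ring.Span R K (residue_list us) = {cls p | p. Poly_Mapping.keys p \<subseteq> U}"
      using Span_residue_list[of us] us(1) U(1) by simp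
    ultimately show ?thesis using U(2) unfolding span_of_def by (smt (verit) Collect_cong subset_trans)
  qed
  ultimately have "ring.dimension R (length (residue_list us)) K (span_of D)"
    by (rule cls.S.dimensionI[OF subfield_scalars])
  moreover have "length (residue_list us) = card U" using us distinct_card[of us] by simp
  ultimately show ?thesis by simp
qed

text \<open>
  The length of an independent list is at most the dimension. Applied to finite subsets, this also
  forces \<open>V\<close> to be finite.
\<close>

lemma independent_card_le:
  assumes "basis_mod D U" "D \<subseteq> terms n" "finite U" "V \<subseteq> D" "independent_mod V"
  shows "finite V \<and> card V \<le> card U"
proof -
  interpret cls: ring_hom_ring P R cls by (rule cls_hom)
  have le: "card W \<le> card U" if W: "W \<subseteq> V" "finite W" for W
  proof -
    obtain us where us: "set us = W" "distinct us" using finite_distinct_list[OF W(2)] by blast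
    have "ring.independent R K (residue_list us)"
      using us W assms(2,4,5) unfolding independent_mod_def
      by (intro independent_residue_list) (auto simp: independent_mod_def)
    moreover have "set (residue_list us) \<subseteq> span_of D"
      using us W assms(4) by (force simp: span_of_def monomial_def)
    ultimately have "length (residue_list us) \<le> card U"
      by (rule cls.S.independent_length_le_dimension[OF subfield_scalars dimension_basis[OF assms(1-3)]])
    then show ?thesis using us distinct_card[of us] by simp
  qed
  have "finite V"
  proof (rule ccontr)
    assume "infinite V"
    then obtain W where "W \<subseteq> V" "finite W" "card W = Suc (card U)"
      using infinite_arbitrarily_large by blast
    then show False using le[of W] by simp
  qed
  then show ?thesis using le by blast
qed

lemma HF_affine_basis:
  assumes "basis_mod {t \<in> terms n. tdeg t \<le> i} U" "finite U"
  shows "HF_affine n I i = card U"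
proof -
  interpret cls: ring_hom_ring P R cls by (rule cls_hom)
  have "degree_filtration n I i = span_of {t \<in> terms n. tdeg t \<le> i}"
    unfolding degree_filtration_def span_of_def cls_def affine_carrier_iff by (auto simp: subset_iff)
  moreover have "ring.dimension R (card U) K (span_of {t \<in> terms n. tdeg t \<le> i})"
    using assms by (intro dimension_basis) auto
  ultimately show ?thesis unfolding HF_affine_def
    using cls.S.dimI[OF subfield_scalars] by (simp add: over_def)
qed

end

section \<open>Standard terms\<close>

text \<open>
  The degree lexicographic ordering. Degree compatibility is what makes the standard terms a degree
  filtered basis.
\<close>

definition term_less :: "(nat \<Rightarrow>\<^sub>0 nat) \<Rightarrow> (nat \<Rightarrow>\<^sub>0 nat) \<Rightarrow> bool" where
  "term_less s t \<longleftrightarrow> tdeg s < tdeg t \<or> tdeg s = tdeg t \<and> s < t"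

lemma term_less_add: "term_less s t \<Longrightarrow> term_less (u + s) (u + t)"
  by (auto simp: term_less_def tdeg_add)

lemma term_less_trans: "term_less s t \<Longrightarrow> term_less t u \<Longrightarrow> term_less s u"
  by (auto simp: term_less_def)

lemma term_less_irrefl: "\<not> term_less t t"
  by (simp add: term_less_def)

lemma term_less_tdeg: "term_less s t \<Longrightarrow> tdeg s \<le> tdeg t"
  by (auto simp: term_less_def)

lemma finite_terms_tdeg_le: "finite {t \<in> terms n. tdeg t \<le> d}"
proof (induction d)
  case 0
  have "{t \<in> terms n. tdeg t \<le> 0} \<subseteq> {0}" by auto
  then show ?case by (rule finite_subset) simp
next
  case (Suc d)
  have "{t \<in> terms n. tdeg t \<le> Suc d} \<subseteq> {0} \<union> (\<Union>r\<in>{..<n}. (+) (xvar r) ` {t \<in> terms n. tdeg t \<le> d})"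
  proof
    fix t assume t: "t \<in> {t \<in> terms n. tdeg t \<le> Suc d}"
    then have "t \<in> terms n" by simp
    then show "t \<in> {0} \<union> (\<Union>r\<in>{..<n}. (+) (xvar r) ` {t \<in> terms n. tdeg t \<le> d})"
      by (cases rule: term_cases) (use t in \<open>auto simp: tdeg_add\<close>)
  qed
  then show ?case by (rule finite_subset) (use Suc in simp)
qed

text \<open>
  Well-founded because a term has only finitely many predecessors, their degrees being bounded.
\<close>

lemma term_less_induct [consumes 1, case_names less]:
  assumes "t \<in> terms n"
    and "\<And>t. t \<in> terms n \<Longrightarrow> (\<And>s. s \<in> terms n \<Longrightarrow> term_less s t \<Longrightarrow> P s) \<Longrightarrow> P t"
  shows "P t"
  using assms(1)
proof (induction "card {s \<in> terms n. term_less s t}" arbitrary: t rule: less_induct)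
  case less
  show ?case
  proof (rule assms(2)[OF less.prems])
    fix s assume s: "s \<in> terms n" "term_less s t"
    have "finite {s \<in> terms n. term_less s t}"
      by (rule finite_subset[OF _ finite_terms_tdeg_le[of n "tdeg t"]]) (auto dest: term_less_tdeg)
    moreover have "{r \<in> terms n. term_less r s} \<subset> {s \<in> terms n. term_less s t}"
      using s term_less_trans term_less_irrefl by blast
    ultimately show "P s" using less.hyps s(1) psubset_card_mono by blast
  qed
qed

lemma term_less_max:
  assumes "finite S" "S \<noteq> {}"
  shows "\<exists>t\<in>S. \<forall>s\<in>S. s \<noteq> t \<longrightarrow> term_less s t"
proof -
  define d where "d = Max (tdeg ` S)"
  define t where "t = Max {s \<in> S. tdeg s = d}"
  have "d \<in> tdeg ` S" unfolding d_def using assms by (intro Max_in) auto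
  then have "{s \<in> S. tdeg s = d} \<noteq> {}" by auto
  then have t: "t \<in> {s \<in> S. tdeg s = d}" unfolding t_def using assms by (intro Max_in) auto
  have "term_less s t" if "s \<in> S" "s \<noteq> t" for s
  proof -
    have "tdeg s \<le> d" unfolding d_def using assms that by (intro Max_ge) auto
    moreover have "s \<le> t" if "tdeg s = d" unfolding t_def using assms \<open>s \<in> S\<close> that by (intro Max_ge) auto
    ultimately show ?thesis using t that unfolding term_less_def by fastforce
  qed
  then show ?thesis using t by blast
qed

context proper_affine_ideal
begin

text \<open>
  The terms that are not leading terms of elements of \<open>I\<close>.
\<close>

definition standard_terms :: "(nat \<Rightarrow>\<^sub>0 nat) set" where
  "standard_terms = {t \<in> terms n. \<not> (\<exists>p. Poly_Mapping.keys p \<subseteq> {s \<in> terms n. term_less s t} \<and>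
     Poly_Mapping.single t 1 - p \<in> I)}"

text \<open>
  If $s$ is a combination of smaller terms modulo $I$, then so is $s u$, the ordering being compatible
  with multiplication.
\<close>

lemma standard_terms_divisor:
  assumes "s + u \<in> standard_terms"
  shows "s \<in> standard_terms"
proof (rule ccontr)
  assume "s \<notin> standard_terms"
  have su: "s \<in> terms n" "u \<in> terms n"
    using assms by (auto simp: standard_terms_def terms_def keys_add_nat)
  then obtain p where p: "Poly_Mapping.keys p \<subseteq> {r \<in> terms n. term_less r s}" "Poly_Mapping.single s 1 - p \<in> I"
    using \<open>s \<notin> standard_terms\<close> by (auto simp: standard_terms_def)
  have "Poly_Mapping.single u 1 * (Poly_Mapping.single s 1 - p) \<in> I"
    using I(4)[OF single_in_P[OF su(2)] p(2)] .
  then have "Poly_Mapping.single (s + u) 1 - Poly_Mapping.single u 1 * p \<in> I"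
    by (simp add: right_diff_distrib mult_single add.commute)
  moreover have "Poly_Mapping.keys (Poly_Mapping.single u 1 * p) \<subseteq> {r \<in> terms n. term_less r (s + u)}"
  proof
    fix r assume "r \<in> Poly_Mapping.keys (Poly_Mapping.single u 1 * p)"
    then obtain r' where "r = u + r'" "r' \<in> Poly_Mapping.keys p"
      using keys_mult[of "Poly_Mapping.single u (1 :: 'a)" p] by auto
    then show "r \<in> {r \<in> terms n. term_less r (s + u)}"
      using p(1) su(2) term_less_add[of r' s u] by (auto simp: terms_def keys_add_nat add.commute)
  qed
  ultimately show False using assms by (auto simp: standard_terms_def)
qed

text \<open>
  The largest term of a nontrivial relation would be a combination of smaller ones.
\<close>

lemma standard_terms_independent: "independent_mod standard_terms"
  unfolding independent_mod_def
proof (intro allI impI, rule ccontr)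
  fix p assume p: "Poly_Mapping.keys p \<subseteq> standard_terms" "p \<in> I" "p \<noteq> 0"
  obtain t where t: "t \<in> Poly_Mapping.keys p" "\<And>s. s \<in> Poly_Mapping.keys p \<Longrightarrow> s \<noteq> t \<Longrightarrow> term_less s t"
    using term_less_max[of "Poly_Mapping.keys p"] p(3) by auto
  define c where "c = inverse (Poly_Mapping.lookup p t)"
  define q where "q = Poly_Mapping.single t 1 - Poly_Mapping.single 0 c * p"
  have look: "Poly_Mapping.lookup (Poly_Mapping.single 0 c * p) s = c * Poly_Mapping.lookup p s" for s
    unfolding mult_map_scale_conv_mult[symmetric] by (simp add: Poly_Mapping.map.rep_eq when_def)
  have "Poly_Mapping.keys q \<subseteq> {s \<in> terms n. term_less s t}"
  proof
    fix s assume s: "s \<in> Poly_Mapping.keys q"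
    have "c * Poly_Mapping.lookup p t = 1" using t(1) by (simp add: c_def in_keys_iff)
    then have "Poly_Mapping.lookup q t = 0" by (simp add: q_def lookup_minus look)
    then have "s \<noteq> t" using s by (auto simp: in_keys_iff)
    have "s \<in> Poly_Mapping.keys p"
      using s \<open>s \<noteq> t\<close> by (auto simp: q_def in_keys_iff lookup_minus look lookup_single when_def)
    then show "s \<in> {s \<in> terms n. term_less s t}"
      using t(2) p(1) \<open>s \<noteq> t\<close> by (auto simp: standard_terms_def)
  qed
  moreover have "Poly_Mapping.single t 1 - q \<in> I"
    using I(4)[OF single_in_P[OF zero_in_terms] p(2)] by (simp add: q_def)
  ultimately show False using t(1) p(1) by (auto simp: standard_terms_def)
qed

text \<open>
  Rewriting a nonstandard term by smaller terms terminates, and does not raise the degree.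
\<close>

lemma reduce_to_standard:
  assumes "Poly_Mapping.keys p \<subseteq> {t \<in> terms n. tdeg t \<le> i}"
  shows "\<exists>q. Poly_Mapping.keys q \<subseteq> {t \<in> standard_terms. tdeg t \<le> i} \<and> p - q \<in> I"
proof -
  let ?R = "\<lambda>i p. \<exists>q. Poly_Mapping.keys q \<subseteq> {t \<in> standard_terms. tdeg t \<le> i} \<and> p - q \<in> I"
  have add: "?R i (p1 + p2)" if "?R i p1" "?R i p2" for p1 p2 i
  proof -
    from that obtain q1 q2 where q: "Poly_Mapping.keys q1 \<subseteq> {t \<in> standard_terms. tdeg t \<le> i}" "p1 - q1 \<in> I"
      "Poly_Mapping.keys q2 \<subseteq> {t \<in> standard_terms. tdeg t \<le> i}" "p2 - q2 \<in> I" by blast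
    have "(p1 + p2) - (q1 + q2) = (p1 - q1) + (p2 - q2)" by simp
    also have "\<dots> \<in> I" using q I(2) by blast
    finally show ?thesis using q Poly_Mapping.keys_add[of q1 q2] by blast
  qed
  have zero: "?R i 0" for i using I(1) by (intro exI[of _ 0]) simp
  have single: "\<forall>c. ?R (tdeg t) (Poly_Mapping.single t c)" if "t \<in> terms n" for t
    using that
  proof (induction t rule: term_less_induct)
    case (less t)
    show ?case
    proof (intro allI, cases "t \<in> standard_terms")
      case True
      fix c show "?R (tdeg t) (Poly_Mapping.single t c)"
        using True I(1) by (intro exI[of _ "Poly_Mapping.single t c"]) auto
    next
      case False
      fix c
      obtain p where p: "Poly_Mapping.keys p \<subseteq> {s \<in> terms n. term_less s t}" "Poly_Mapping.single t 1 - p \<in> I"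
        using False less.hyps by (auto simp: standard_terms_def)
      have "?R (tdeg t) (Poly_Mapping.single 0 c * p)"
      proof (rule poly_mapping_additive_induct[of _ p])
        show "?R (tdeg t) (Poly_Mapping.single 0 c * 0)" using zero by simp
        show "?R (tdeg t) (Poly_Mapping.single 0 c * (a + b))"
          if "?R (tdeg t) (Poly_Mapping.single 0 c * a)" "?R (tdeg t) (Poly_Mapping.single 0 c * b)" for a b
          using add[OF that] by (simp add: distrib_left)
        fix s assume "s \<in> Poly_Mapping.keys p"
        then have s: "s \<in> terms n" "term_less s t" using p(1) by auto
        from less.IH[OF s] obtain q where "Poly_Mapping.keys q \<subseteq> {t \<in> standard_terms. tdeg t \<le> tdeg s}"
          "Poly_Mapping.single s (c * Poly_Mapping.lookup p s) - q \<in> I" by blast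
        then show "?R (tdeg t) (Poly_Mapping.single 0 c * Poly_Mapping.single s (Poly_Mapping.lookup p s))"
          using term_less_tdeg[OF s(2)] by (intro exI[of _ q]) (auto simp: mult_single)
      qed
      then obtain q where q: "Poly_Mapping.keys q \<subseteq> {s \<in> standard_terms. tdeg s \<le> tdeg t}"
        "Poly_Mapping.single 0 c * p - q \<in> I" by blast
      have "Poly_Mapping.single t c - q
          = Poly_Mapping.single 0 c * (Poly_Mapping.single t 1 - p) + (Poly_Mapping.single 0 c * p - q)"
        by (simp add: right_diff_distrib mult_single)
      also have "\<dots> \<in> I" using q(2) I(4)[OF single_in_P[OF zero_in_terms] p(2)] I(2) by blast
      finally show "?R (tdeg t) (Poly_Mapping.single t c)" using q(1) by blast
    qed
  qed
  show ?thesis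
  proof (rule poly_mapping_additive_induct[of _ p])
    fix t assume "t \<in> Poly_Mapping.keys p"
    then have t: "t \<in> terms n" "tdeg t \<le> i" using assms by auto
    from single[OF t(1)] obtain q where "Poly_Mapping.keys q \<subseteq> {s \<in> standard_terms. tdeg s \<le> tdeg t}"
      "Poly_Mapping.single t (Poly_Mapping.lookup p t) - q \<in> I" by blast
    then show "?R i (Poly_Mapping.single t (Poly_Mapping.lookup p t))"
      using t(2) by (intro exI[of _ q]) auto
  qed (use zero add in blast)+
qed

lemma standard_terms_subset: "standard_terms \<subseteq> terms n"
  by (auto simp: standard_terms_def)

lemma standard_terms_degree_basis:
  "basis_mod {t \<in> terms n. tdeg t \<le> i} {t \<in> standard_terms. tdeg t \<le> i}"
  using reduce_to_standard standard_terms_independent standard_terms_subset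
  by (auto simp: basis_mod_def independent_mod_def subset_iff)

lemma standard_terms_basis: "basis_mod (terms n) standard_terms"
proof -
  have "\<exists>q. Poly_Mapping.keys q \<subseteq> standard_terms \<and> p - q \<in> I" if p: "Poly_Mapping.keys p \<subseteq> terms n" for p
  proof -
    define i where "i = Max (tdeg ` Poly_Mapping.keys p)"
    have "Poly_Mapping.keys p \<subseteq> {t \<in> terms n. tdeg t \<le> i}"
      using p unfolding i_def by auto
    from reduce_to_standard[OF this] show ?thesis by blast
  qed
  then show ?thesis using standard_terms_independent standard_terms_subset
    by (simp add: basis_mod_def)
qed

text \<open>
  A finite basis \<open>U\<close> of the whole ring bounds the number of standard terms. Since they contain a basis
  of each $F_i$, their degrees determine the affine Hilbert function.
\<close>

lemma standard_terms_order_ideal: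
  assumes "basis_mod (terms n) U" "finite U"
  shows "order_ideal n standard_terms" "card standard_terms = card U"
    "HF_affine n I = HF_order_ideal standard_terms"
proof -
  have fin: "finite standard_terms \<and> card standard_terms \<le> card U"
    using independent_card_le[OF assms(1) _ assms(2)] standard_terms_subset standard_terms_independent by blast
  moreover have "card U \<le> card standard_terms"
    using independent_card_le[OF standard_terms_basis _ _ _] fin assms(1) by (auto simp: basis_mod_def)
  ultimately show "card standard_terms = card U" by simp
  have "standard_terms \<noteq> {}"
  proof -
    have p0: "p = 0" if "Poly_Mapping.keys p \<subseteq> {s \<in> terms n. term_less s 0}" for p :: "(nat, 'a) mpoly"
    proof -
      have "tdeg (0 :: nat \<Rightarrow>\<^sub>0 nat) = 0" by simp
      then have "\<not> term_less s 0" for s unfolding term_less_def by (metis less_irrefl not_less_zero tdeg_eq_0_iff)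
      then show ?thesis using that by (auto simp flip: keys_eq_empty)
    qed
    have "0 \<in> standard_terms" unfolding standard_terms_def
    proof (clarsimp)
      fix p assume "Poly_Mapping.keys p \<subseteq> {s \<in> terms n. term_less s 0}" "1 - p \<in> I"
      then show False using p0[of p] proper by simp
    qed
    then show ?thesis by blast
  qed
  then show "order_ideal n standard_terms"
    unfolding order_ideal_def using fin standard_terms_subset standard_terms_divisor by blast
  show "HF_affine n I = HF_order_ideal standard_terms"
  proof
    fix i show "HF_affine n I i = HF_order_ideal standard_terms i"
      using HF_affine_basis[OF standard_terms_degree_basis] fin by (simp add: HF_order_ideal_def)
  qed
qed

end

section \<open>Hilbert functions at rational points\<close>

context border_point
begin

lemma one_notin_I: "1 \<notin> I"
proof
  assume "1 \<in> I"
  then have "coords 1 = 0\<^sub>v \<mu>" by (rule I_subset_kernel)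
  moreover have "coords 1 = unit_vec \<mu> 0"
    using coords_single[of 0 1] term_vec_zero by (simp add: single_one)
  ultimately show False using unit_vec_nonzero[OF ts_order_ideal(3)] by metis
qed

sublocale RG: proper_affine_ideal n "point_ideal n ts bs \<Gamma>"
  by (intro proper_affine_ideal.intro I_ideal one_notin_I)

lemma order_ideal_basis: "RG.basis_mod (terms n) (set ts)"
  unfolding RG.basis_mod_def RG.independent_mod_def
  using ts_order_ideal(5) I_subset_kernel kernel_order_ideal reduce by (auto simp: affine_carrier_iff)

text \<open>
  The order ideal of standard terms of $R_\Gamma$ has $\mu$ elements, as $R_\Gamma$ has the given order
  ideal as a basis.
\<close>

lemma degree_filtered_order_ideal:
  obtains T where "order_ideal n T" "card T = \<mu>" "HF_affine n I = HF_order_ideal T"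
    "\<And>us. distinct us \<Longrightarrow> set us = T \<Longrightarrow> ev (det (dfb_mat n ts bs us)) \<noteq> 0"
proof
  note st = RG.standard_terms_order_ideal[OF order_ideal_basis finite_set]
  show "order_ideal n RG.standard_terms" "HF_affine n I = HF_order_ideal RG.standard_terms"
    by (fact st)+
  show card: "card RG.standard_terms = \<mu>" using st(2) ts_order_ideal(2) by (simp add: distinct_card)
  show "ev (det (dfb_mat n ts bs us)) \<noteq> 0" if us: "distinct us" "set us = RG.standard_terms" for us
  proof -
    have "length us = \<mu>" using us card distinct_card[OF us(1)] by simp
    then show ?thesis
      using det_dfb_mat_nonzero_iff[of us] us RG.standard_terms_subset RG.standard_terms_independent
      unfolding RG.independent_mod_def by blast
  qed
qed

text \<open>
  The terms of \<open>us\<close> of degree at most $i$ are linearly independent elements of $F_i$. As the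
  hypothesis is an open condition on $\Gamma$, this is the semicontinuity of the Hilbert function.
\<close>

lemma HF_ge_of_det_nonzero:
  assumes "length us = \<mu>" "distinct us" "set us \<subseteq> terms n" "ev (det (dfb_mat n ts bs us)) \<noteq> 0"
  shows "HF_order_ideal (set us) i \<le> HF_affine n I i"
proof -
  let ?D = "{t \<in> terms n. tdeg t \<le> i}" and ?U = "{t \<in> RG.standard_terms. tdeg t \<le> i}"
  have fin: "finite ?U"
    by (rule finite_subset[OF _ finite_terms_tdeg_le[of n i]]) (use RG.standard_terms_subset in auto)
  have "RG.independent_mod (set us)"
    using det_dfb_mat_nonzero_iff[OF assms(1-3)] assms(4) by (simp add: RG.independent_mod_def)
  then have "RG.independent_mod {t \<in> set us. tdeg t \<le> i}"
    unfolding RG.independent_mod_def by (simp add: subset_iff)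
  then have "card {t \<in> set us. tdeg t \<le> i} \<le> card ?U"
    by (intro conjunct2[OF RG.independent_card_le[OF RG.standard_terms_degree_basis[of i] _ fin]])
      (use assms(3) in auto)
  then show ?thesis
    using RG.HF_affine_basis[OF RG.standard_terms_degree_basis fin] by (simp add: HF_order_ideal_def)
qed

end

section \<open>Points of the spectrum\<close>

lemma prime_of_primeideal:
  assumes "primeideal \<pp> (mpoly_ring V :: ('v, 'a::comm_ring_1) mpoly ring)"
  shows "prime_of (carrier (mpoly_ring V)) \<pp>"
proof -
  interpret primeideal \<pp> "mpoly_ring V :: ('v, 'a) mpoly ring" by fact
  have "1 \<notin> \<pp>" using one_imp_carrier I_notcarr by auto
  then show ?thesis
    unfolding prime_of_def
    using additive_subgroup.zero_closed[OF additive_subgroup_axioms] a_subset I_prime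
      additive_subgroup.a_closed[OF additive_subgroup_axioms] I_l_closed by auto
qed

lemma topspace_zariski:
  assumes "cring R"
  shows "topspace (zariski R) = Spec R"
proof -
  interpret cring R by fact
  have "zero_set R {\<one>\<^bsub>R\<^esub>} = {}"
  proof -
    have "\<one>\<^bsub>R\<^esub> \<notin> \<pp>" if "primeideal \<pp> R" for \<pp>
    proof -
      interpret primeideal \<pp> R by fact
      show ?thesis using one_imp_carrier I_notcarr by auto
    qed
    then show ?thesis by (auto simp: zero_set_def Spec_def)
  qed
  then have "openin (zariski R) (Spec R)"
    unfolding openin_zariski[OF assms] by (intro exI[of _ "{\<one>\<^bsub>R\<^esub>}"]) auto
  then have "Spec R \<subseteq> topspace (zariski R)" by (rule openin_subset)
  moreover have "topspace (zariski R) \<subseteq> Spec R"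
    using openin_topspace[of "zariski R"] unfolding openin_zariski[OF assms] by auto
  ultimately show ?thesis by blast
qed

lemma cring_coeff_ring: "cring (coeff_ring ts bs)"
  unfolding coeff_ring_def by (rule cring_mpoly_ring)

lemma primeideal_spec_point:
  fixes \<Gamma> :: "'k::field alg_closure mat"
  shows "primeideal (spec_point ts bs \<Gamma>) (coeff_ring ts bs)"
proof -
  interpret ev: comm_ring_hom "eval_at \<Gamma> :: 'k cpoly \<Rightarrow> 'k alg_closure" by (rule comm_ring_hom_eval_at)
  have "subring_of (carrier (coeff_ring ts bs) :: 'k cpoly set)"
    unfolding coeff_ring_def by (rule subring_mpoly_ring)
  note S = subring_ofD[OF this]
  show ?thesis
  proof (rule primeidealI)
    show "ideal (spec_point ts bs \<Gamma>) (coeff_ring ts bs)"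
      using S unfolding coeff_ring_def
      by (intro mpoly_idealI) (auto simp: spec_point_def coeff_ring_def hom_distribs)
    show "cring (coeff_ring ts bs :: 'k cpoly ring)" by (rule cring_coeff_ring)
    show "carrier (coeff_ring ts bs) \<noteq> spec_point ts bs \<Gamma>"
    proof
      assume "carrier (coeff_ring ts bs) = spec_point ts bs \<Gamma>"
      then have "(1 :: 'k cpoly) \<in> spec_point ts bs \<Gamma>" using S(2) by blast
      then have "eval_at \<Gamma> (1 :: 'k cpoly) = 0" by (simp add: spec_point_def)
      then show False by simp
    qed
    show "a \<in> spec_point ts bs \<Gamma> \<or> b \<in> spec_point ts bs \<Gamma>"
      if "a \<in> carrier (coeff_ring ts bs)" "b \<in> carrier (coeff_ring ts bs)"
        "a \<otimes>\<^bsub>coeff_ring ts bs\<^esub> b \<in> spec_point ts bs \<Gamma>" for a b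
      using that by (auto simp: spec_point_def coeff_ring_def hom_distribs)
  qed
qed

lemma spec_point_in_border_scheme:
  fixes \<Gamma> :: "'k::field alg_closure mat"
  assumes "border_scheme_ideal n ts bs \<subseteq> (carrier (coeff_ring ts bs) :: 'k cpoly set)" "\<Gamma> \<in> rational_points n ts bs"
  shows "spec_point ts bs \<Gamma> \<in> border_scheme n ts bs"
  using assms primeideal_spec_point
  by (auto simp: border_scheme_def zero_set_def Spec_def rational_points_def spec_point_def)

text \<open>
  A zero of $\mathfrak{p}$ is a rational point of the scheme because $\mathfrak{p}$ contains the ideal
  of the scheme.
\<close>

lemma rational_point_nullstellensatz:
  fixes \<pp> :: "'k::field cpoly set"
  assumes \<pp>: "\<pp> \<in> border_scheme n ts bs" and f: "f \<in> carrier (coeff_ring ts bs)" "f \<notin> \<pp>"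
  shows "\<exists>\<Gamma>\<in>rational_points n ts bs. \<pp> \<subseteq> spec_point ts bs \<Gamma> \<and> eval_at \<Gamma> f \<noteq> 0"
proof -
  define V where "V = {..<length ts} \<times> {..<length bs}"
  have R: "coeff_ring ts bs = (mpoly_ring V :: 'k cpoly ring)" by (simp add: coeff_ring_def V_def)
  have prime: "prime_of (carrier (mpoly_ring V)) \<pp>"
    using \<pp> by (intro prime_of_primeideal) (auto simp: border_scheme_def zero_set_def Spec_def R)
  have "\<exists>\<gamma>. (\<forall>p\<in>\<pp>. mpoly_eval to_ac \<gamma> p = 0) \<and> mpoly_eval to_ac \<gamma> f \<noteq> 0"
    by (rule nullstellensatz[OF _ _ prime]) (use f in \<open>unfold_locales, auto simp: V_def R\<close>)
  then obtain \<gamma> where \<gamma>: "\<And>p. p \<in> \<pp> \<Longrightarrow> mpoly_eval to_ac \<gamma> p = 0" "mpoly_eval to_ac \<gamma> f \<noteq> 0" by blast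
  define \<Gamma> where "\<Gamma> = mat (length ts) (length bs) \<gamma>"
  have ev: "eval_at \<Gamma> p = mpoly_eval to_ac \<gamma> p" if "p \<in> carrier (coeff_ring ts bs)" for p
    unfolding eval_at_def using that[unfolded R]
    by (rule mpoly_eval_cong) (auto simp: \<Gamma>_def V_def)
  have sub: "\<pp> \<subseteq> carrier (coeff_ring ts bs)" using prime by (auto simp: prime_of_def R)
  have "\<pp> \<subseteq> spec_point ts bs \<Gamma>" using \<gamma>(1) ev sub by (auto simp: spec_point_def)
  moreover have "border_scheme_ideal n ts bs \<subseteq> \<pp>" using \<pp> by (simp add: border_scheme_def zero_set_def)
  ultimately have "\<Gamma> \<in> rational_points n ts bs"
    by (auto simp: rational_points_def spec_point_def \<Gamma>_def)
  then show ?thesis using \<open>\<pp> \<subseteq> spec_point ts bs \<Gamma>\<close> \<gamma>(2) ev[OF f(1)] by auto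
qed

section \<open>The determinants as elements of the coordinate ring\<close>

definition entries_in :: "'a set \<Rightarrow> 'a mat \<Rightarrow> bool" where
  "entries_in S M \<longleftrightarrow> (\<forall>i<dim_row M. \<forall>j<dim_col M. M $$ (i, j) \<in> S)"

lemma entries_in_mult:
  assumes "subring_of S" "entries_in S M" "entries_in S N" "dim_col M = dim_row N"
  shows "entries_in S (M * N)"
  using assms(2-4) unfolding entries_in_def
  by (auto simp: scalar_prod_def intro!: subring_ofD(4,8)[OF assms(1)])

lemma entries_in_pow:
  assumes "subring_of S" "entries_in S M" "M \<in> carrier_mat m m"
  shows "entries_in S (M ^\<^sub>m k)"
proof (induction k)
  case 0
  then show ?case using subring_ofD(1,2)[OF assms(1)] by (simp add: entries_in_def)
next
  case (Suc k)
  then show ?case using entries_in_mult[OF assms(1) Suc assms(2)] assms(3) by simp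
qed

lemma det_in_subring:
  assumes "subring_of S" "entries_in S M"
  shows "det M \<in> S"
proof -
  note S = subring_ofD[OF assms(1)]
  have prod: "(\<Prod>i\<in>F. g i) \<in> S" if "\<And>i. i \<in> F \<Longrightarrow> g i \<in> S" for F :: "nat set" and g
    using that S(2,4) by (induction F rule: infinite_finite_induct) auto
  have sign: "signof p \<in> S" for p :: "nat \<Rightarrow> nat" using S(2,5) by (auto simp: sign_def)
  show ?thesis
  proof (cases "dim_row M = dim_col M")
    case True
    have "M $$ (i, p i) \<in> S" if "p permutes {0..<dim_row M}" "i \<in> {0..<dim_row M}" for p i
      using assms(2) that permutes_in_image[OF that(1)] True by (simp add: entries_in_def)
    then show ?thesis using True unfolding det_def by (auto intro!: S(8) S(4) sign prod)
  qed (simp add: det_def S(1))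
qed

lemma det_dfb_mat_in_coeff_ring:
  assumes ts: "ordered_order_ideal n ts" and bs: "distinct bs" "set bs = border n (set ts)"
  shows "det (dfb_mat n ts bs us) \<in> (carrier (coeff_ring ts bs) :: 'k::field cpoly set)"
proof -
  let ?S = "carrier (coeff_ring ts bs) :: 'k cpoly set"
  let ?G = "generic_mult_mat ts bs :: nat \<Rightarrow> 'k cpoly mat"
  have sub: "subring_of ?S" unfolding coeff_ring_def by (rule subring_mpoly_ring)
  note S = subring_ofD[OF sub]
  have G: "?G r \<in> carrier_mat (length ts) (length ts)" for r by (simp add: generic_mult_mat_def)
  have entG: "entries_in ?S (?G r)" if r: "r < n" for r
    unfolding entries_in_def
  proof (intro allI impI)
    fix i j assume "i < dim_row (?G r)" "j < dim_col (?G r)"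
    then have ij: "i < length ts" "j < length ts" using G[of r] by auto
    show "?G r $$ (i, j) \<in> ?S"
    proof (cases "xvar r + ts ! j \<in> set ts")
      case True
      then show ?thesis using ij S(1,2) by (simp add: generic_mult_mat_def Let_def)
    next
      case False
      then have "xvar r + ts ! j \<in> set bs" using bs(2) r nth_mem[OF ij(2)] unfolding border_def by blast
      then obtain m where m: "m < length bs" "bs ! m = xvar r + ts ! j" by (metis in_set_conv_nth)
      then have "(THE k. k < length bs \<and> bs ! k = xvar r + ts ! j) = m"
        by (intro the_equality) (use m nth_eq_iff_index_eq[OF bs(1)] in metis)+
      then have "?G r $$ (i, j) = monomial 1 (xvar (i, m))"
        using False ij by (simp add: generic_mult_mat_def Let_def)
      also have "\<dots> \<in> ?S" unfolding coeff_ring_def using ij m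
        by (intro monomial_in_mpoly_ring) (simp add: xvar_def)
      finally show ?thesis .
    qed
  qed
  have ent: "mat_term_prod (length ts) ?G rs t \<in> carrier_mat (length ts) (length ts)
      \<and> entries_in ?S (mat_term_prod (length ts) ?G rs t)" if "set rs \<subseteq> {..<n}" for rs t
    using that
  proof (induction rs)
    case Nil
    show ?case using S(1,2) by (simp add: mat_term_prod_def entries_in_def)
  next
    case (Cons r rs)
    let ?A = "?G r ^\<^sub>m Poly_Mapping.lookup t r" and ?B = "mat_term_prod (length ts) ?G rs t"
    have A: "?A \<in> carrier_mat (length ts) (length ts)" using G by simp
    have B: "?B \<in> carrier_mat (length ts) (length ts)" "entries_in ?S ?B" using Cons by auto
    have "entries_in ?S ?A" using entries_in_pow[OF sub entG G] Cons.prems by simp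
    then have "entries_in ?S (?A * ?B)" using A B by (intro entries_in_mult[OF sub]) auto
    moreover have "?A * ?B \<in> carrier_mat (length ts) (length ts)" using A B by simp
    ultimately show ?case by (simp add: mat_term_prod_def)
  qed
  have pos: "0 < length ts" using ts by (auto simp: ordered_order_ideal_def order_ideal_def)
  have "entries_in ?S (dfb_mat n ts bs us)"
    unfolding entries_in_def
  proof (intro allI impI)
    fix i j assume "i < dim_row (dfb_mat n ts bs us :: 'k cpoly mat)" "j < dim_col (dfb_mat n ts bs us :: 'k cpoly mat)"
    then have ij: "i < length ts" "j < length us" by (simp_all add: dfb_mat_def)
    have tm: "term_mat n ts bs t = mat_term_prod (length ts) ?G [0..<n] t" for t
      by (simp add: term_mat_def mat_term_prod_def)
    have e: "(term_mat n ts bs (us ! j) :: 'k cpoly mat) \<in> carrier_mat (length ts) (length ts)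
      \<and> entries_in ?S (term_mat n ts bs (us ! j))" unfolding tm by (rule ent) auto
    then have dims: "dim_row (term_mat n ts bs (us ! j) :: 'k cpoly mat) = length ts"
      "dim_col (term_mat n ts bs (us ! j) :: 'k cpoly mat) = length ts" by auto
    then have "dfb_mat n ts bs us $$ (i, j) = (term_mat n ts bs (us ! j) $$ (i, 0) :: 'k cpoly)"
      using ij pos by (simp add: dfb_mat_def mat_of_cols_index)
    then show "(dfb_mat n ts bs us $$ (i, j) :: 'k cpoly) \<in> ?S"
      using e ij pos dims by (simp add: entries_in_def)
  qed
  then show ?thesis by (rule det_in_subring[OF sub])
qed

section \<open>The open covering\<close>

lemma border_scheme_ideal_subset:
  fixes \<pp> :: "'k::field cpoly set"
  assumes "\<pp> \<in> border_scheme n ts bs"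
  shows "(border_scheme_ideal n ts bs :: 'k cpoly set) \<subseteq> carrier (coeff_ring ts bs)"
proof -
  have "primeideal \<pp> (coeff_ring ts bs)" and sub: "border_scheme_ideal n ts bs \<subseteq> \<pp>"
    using assms by (auto simp: border_scheme_def zero_set_def Spec_def)
  then interpret primeideal \<pp> "coeff_ring ts bs" by blast
  show ?thesis using sub a_subset by blast
qed

text \<open>
  The points of the closed stratum detect functions outside $\mathfrak{p}$, and some function \<open>f\<close>
  outside $\mathfrak{p}$ vanishes at all points with strictly smaller Hilbert function. If
  all determinants were in $\mathfrak{p}$, a zero $\Gamma$ of $\mathfrak{p}$ with $f(\Gamma) \ne 0$ would
  have a Hilbert function strictly below \<open>H\<close>.
\<close>

lemma stratum_covering:
  fixes ts bs :: "(nat \<Rightarrow>\<^sub>0 nat) list"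
  assumes ts: "ordered_order_ideal n ts" and bs: "distinct bs" "set bs = border n (set ts)"
    and tss: "\<forall>ts'\<in>set tss. distinct ts'"
      "set (map set tss) = {T. order_ideal n T \<and> HF_order_ideal T = H}"
    and \<pp>: "(\<pp> :: 'k::field cpoly set) \<in> stratum n ts bs H"
  shows "\<exists>ts'\<in>set tss. det (dfb_mat n ts bs ts') \<notin> \<pp>"
proof (rule ccontr)
  assume "\<not> ?thesis"
  then have dets: "\<And>ts'. ts' \<in> set tss \<Longrightarrow> det (dfb_mat n ts bs ts') \<in> \<pp>" by blast
  let ?R = "coeff_ring ts bs :: 'k cpoly ring" and ?B = "border_scheme n ts bs :: 'k cpoly set set"
  let ?X = "subtopology (zariski ?R) ?B"
  define HF where "HF \<Gamma> = HF_affine n (point_ideal n ts bs \<Gamma>)" for \<Gamma> :: "'k alg_closure mat"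
  define S where "S = {\<Gamma> \<in> rational_points n ts bs. dominates H (HF \<Gamma>)}"
  define S' where "S' = {\<Gamma> \<in> rational_points n ts bs. strictly_dominates H (HF \<Gamma>)}"
  have \<pp>1: "\<pp> \<in> ?X closure_of (spec_point ts bs ` S)"
    and \<pp>2: "\<pp> \<notin> ?X closure_of (spec_point ts bs ` S')"
    using \<pp> by (simp_all add: stratum_def closed_stratum_def S_def S'_def HF_def)
  have top: "topspace ?X = Spec ?R \<inter> ?B" by (simp add: topspace_zariski cring_coeff_ring)
  have \<pp>X: "\<pp> \<in> Spec ?R" "\<pp> \<in> ?B"
    using \<pp>1 top unfolding in_closure_of by auto
  note opn = openin_zariski[OF cring_coeff_ring[of ts bs, where 'a='k]]
  \<comment> \<open>A function outside the prime is nonzero at some point of the closed stratum.\<close>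
  have nonvanishing: "\<exists>\<Gamma>\<in>S. eval_at \<Gamma> g \<noteq> 0" if g: "g \<in> carrier ?R" "g \<notin> \<pp>" for g
  proof -
    define U where "U = Spec ?R - zero_set ?R {g}"
    have "openin (zariski ?R) U" unfolding U_def opn using g(1) by blast
    then have "openin ?X (U \<inter> ?B)" unfolding openin_subtopology by blast
    moreover have "\<pp> \<in> U \<inter> ?B" using \<pp>X g(2) by (auto simp: U_def zero_set_def)
    ultimately have "\<exists>y. y \<in> spec_point ts bs ` S \<and> y \<in> U \<inter> ?B"
      using conjunct2[OF \<pp>1[unfolded in_closure_of], rule_format, of "U \<inter> ?B"] by blast
    then obtain \<Gamma> where "\<Gamma> \<in> S" "spec_point ts bs \<Gamma> \<in> U" by auto
    then show ?thesis using g(1) by (auto simp: U_def zero_set_def spec_point_def)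
  qed
  obtain f where f: "f \<in> carrier ?R" "f \<notin> \<pp>" "\<And>\<Gamma>. \<Gamma> \<in> S' \<Longrightarrow> eval_at \<Gamma> f = 0"
  proof -
    obtain U where U: "openin ?X U" "\<pp> \<in> U" "U \<inter> spec_point ts bs ` S' = {}"
      using \<pp>2 \<pp>X top unfolding in_closure_of by auto
    then obtain F where F: "F \<subseteq> carrier ?R" "U = (Spec ?R - zero_set ?R F) \<inter> ?B"
      unfolding openin_subtopology opn by blast
    then obtain f where f: "f \<in> F" "f \<notin> \<pp>" using U(2) by (auto simp: zero_set_def)
    have "eval_at \<Gamma> f = 0" if "\<Gamma> \<in> S'" for \<Gamma>
    proof -
      have "\<Gamma> \<in> rational_points n ts bs" using that by (simp add: S'_def)
      then have "spec_point ts bs \<Gamma> \<in> ?B"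
        using border_scheme_ideal_subset[OF \<pp>X(2)] by (intro spec_point_in_border_scheme)
      moreover have "spec_point ts bs \<Gamma> \<in> Spec ?R" using primeideal_spec_point by (auto simp: Spec_def)
      ultimately have "F \<subseteq> spec_point ts bs \<Gamma>" using U(3) F(2) that by (auto simp: zero_set_def)
      then show ?thesis using f(1) by (auto simp: spec_point_def)
    qed
    then show thesis using that f F(1) by blast
  qed
  obtain \<Gamma> where \<Gamma>: "\<Gamma> \<in> rational_points n ts bs" "\<pp> \<subseteq> spec_point ts bs \<Gamma>" "eval_at \<Gamma> f \<noteq> 0"
    using rational_point_nullstellensatz[OF \<pp>X(2) f(1,2)] by blast
  have van: "eval_at \<Gamma> g = 0" if "g \<in> \<pp>" for g using \<Gamma>(2) that by (auto simp: spec_point_def)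
  interpret bp: border_point n ts bs \<Gamma> using ts bs \<Gamma>(1) by unfold_locales
  obtain T where T: "order_ideal n T" "card T = length ts" "HF \<Gamma> = HF_order_ideal T"
    and det_T: "\<And>us. distinct us \<Longrightarrow> set us = T \<Longrightarrow> eval_at \<Gamma> (det (dfb_mat n ts bs us)) \<noteq> 0"
    using bp.degree_filtered_order_ideal unfolding HF_def by blast
  have "finite T" using T(1) by (simp add: order_ideal_def)
  then obtain us where us: "set us = T" "distinct us" using finite_distinct_list by blast
  have len: "length us = length ts" using us T(2) distinct_card[of us] by simp
  have terms: "set us \<subseteq> terms n" using T(1) us(1) by (simp add: order_ideal_def)
  have "det (dfb_mat n ts bs us) \<notin> \<pp>" using det_T us van by blast
  then obtain \<Gamma>' where \<Gamma>': "\<Gamma>' \<in> S" "eval_at \<Gamma>' (det (dfb_mat n ts bs us)) \<noteq> 0"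
    using nonvanishing det_dfb_mat_in_coeff_ring[OF ts bs] by blast
  interpret bp': border_point n ts bs \<Gamma>' using ts bs \<Gamma>'(1) by unfold_locales (auto simp: S_def)
  \<comment> \<open>The terms of \<open>T\<close> stay independent at \<open>\<Gamma>'\<close>, where the Hilbert function is dominated by \<open>H\<close>.\<close>
  have dom: "dominates H (HF \<Gamma>)"
    unfolding dominates_def
  proof
    fix i
    have "HF \<Gamma> i \<le> HF \<Gamma>' i"
      using bp'.HF_ge_of_det_nonzero[OF len us(2) terms \<Gamma>'(2), of i] us(1) T(3) by (simp add: HF_def)
    also have "\<dots> \<le> H i" using \<Gamma>'(1) by (auto simp: S_def dominates_def)
    finally show "HF \<Gamma> i \<le> H i" .
  qed
  have "HF \<Gamma> \<noteq> H"
  proof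
    assume "HF \<Gamma> = H"
    then have "T \<in> set (map set tss)" using tss(2) T by simp
    then obtain ts' where ts': "ts' \<in> set tss" "set ts' = T" by auto
    then show False using det_T[of ts'] tss(1) van[OF dets[OF ts'(1)]] by blast
  qed
  then have "\<Gamma> \<in> S'" using dom \<Gamma>(1) by (auto simp: S'_def strictly_dominates_def)
  then show False using f(3) \<Gamma>(3) by blast
qed

theorem corollary10p3:
  fixes n :: nat
    and ts bs :: "(nat \<Rightarrow>\<^sub>0 nat) list"
    and H :: "nat \<Rightarrow> nat"
    and tss :: "(nat \<Rightarrow>\<^sub>0 nat) list list"
  assumes "ordered_order_ideal n ts"
    and "distinct bs" and "set bs = border n (set ts)"
    and "admissible TYPE('k::field) n (length ts) H"
    and "dominates H (HF_order_ideal (set ts))"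
    and "\<forall>ts'\<in>set tss. ordered_order_ideal n ts'"
    and "distinct (map set tss)"
    and "set (map set tss) = {T. order_ideal n T \<and> HF_order_ideal T = H}"
  shows "(\<forall>i<length tss.
            openin (subtopology (zariski (coeff_ring ts bs)) (closed_stratum n ts bs H))
              (dfb_locus n ts bs (tss ! i) :: 'k cpoly set set)
            \<and> (dfb_locus n ts bs (tss ! i) :: 'k cpoly set set) \<subseteq> stratum n ts bs H)
       \<and> (\<forall>i<length tss.
            openin (subtopology (zariski (coeff_ring ts bs)) (stratum n ts bs H))
              (dfb_locus n ts bs (tss ! i) :: 'k cpoly set set))
       \<and> (\<Union>i<length tss. dfb_locus n ts bs (tss ! i) :: 'k cpoly set set) = stratum n ts bs H"
proof -
  let ?R = "coeff_ring ts bs :: 'k cpoly ring" and ?B = "border_scheme n ts bs :: 'k cpoly set set"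
  let ?X = "zariski ?R"
  let ?St = "stratum n ts bs H :: 'k cpoly set set" and ?CS = "closed_stratum n ts bs H :: 'k cpoly set set"
  define D where "D i = Spec ?R - zero_set ?R {det (dfb_mat n ts bs (tss ! i))}" for i
  have D: "openin ?X (D i)" for i
    unfolding D_def openin_zariski[OF cring_coeff_ring]
    using det_dfb_mat_in_coeff_ring[OF assms(1-3)] by blast
  have top: "topspace ?X = Spec ?R" by (rule topspace_zariski[OF cring_coeff_ring])
  have CS: "?CS \<subseteq> Spec ?R \<inter> ?B"
    unfolding closed_stratum_def
    using closure_of_subset_topspace[of "subtopology ?X ?B"] by (simp add: top)
  have locus: "dfb_locus n ts bs (tss ! i) = ?St \<inter> D i" if i: "i < length tss" for i
  proof -
    have "HF_order_ideal (set (tss ! i)) = H" using assms(8) i by (metis (mono_tags, lifting) length_map mem_Collect_eq nth_map nth_mem)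
    moreover have "?St \<subseteq> Spec ?R" using CS by (auto simp: stratum_def)
    ultimately show ?thesis by (auto simp: dfb_locus_def D_def)
  qed
  \<comment> \<open>The stratum is open in the closed stratum.\<close>
  obtain W where W: "openin ?X W" "?St = ?CS \<inter> W"
  proof -
    let ?Z = "subtopology ?X ?B closure_of (spec_point ts bs `
      {\<Gamma> \<in> rational_points n ts bs. strictly_dominates H (HF_affine n (point_ideal n ts bs \<Gamma>))})"
    obtain Z where Z: "closedin ?X Z" "?Z = Z \<inter> ?B"
      using closedin_closure_of[of "subtopology ?X ?B"] unfolding closedin_subtopology by blast
    have "?St = ?CS - ?Z" by (simp add: stratum_def)
    then have "?St = ?CS \<inter> (topspace ?X - Z)" unfolding Z(2) top using CS by blast
    moreover have "openin ?X (topspace ?X - Z)" using Z(1) by blast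
    ultimately show thesis using that by blast
  qed
  show ?thesis
  proof (intro conjI allI impI)
    fix i assume i: "i < length tss"
    have "dfb_locus n ts bs (tss ! i) = (W \<inter> D i) \<inter> ?CS" using locus[OF i] W(2) by blast
    then show "openin (subtopology ?X ?CS) (dfb_locus n ts bs (tss ! i))"
      using W(1) D[of i] unfolding openin_subtopology by blast
    show "dfb_locus n ts bs (tss ! i) \<subseteq> ?St" using locus[OF i] by blast
    show "openin (subtopology ?X ?St) (dfb_locus n ts bs (tss ! i))"
      using locus[OF i] D[of i] unfolding openin_subtopology by blast
  next
    have "\<pp> \<in> (\<Union>i<length tss. ?St \<inter> D i)" if \<pp>: "\<pp> \<in> ?St" for \<pp>
    proof -
      have "\<forall>ts'\<in>set tss. distinct ts'" using assms(6) by (simp add: ordered_order_ideal_def)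
      then obtain ts' where "ts' \<in> set tss" "det (dfb_mat n ts bs ts') \<notin> \<pp>"
        using stratum_covering[OF assms(1-3) _ assms(8) \<pp>] by blast
      then obtain i where "i < length tss" "det (dfb_mat n ts bs (tss ! i)) \<notin> \<pp>"
        by (metis in_set_conv_nth)
      moreover have "\<pp> \<in> Spec ?R" using \<pp> CS by (auto simp: stratum_def)
      ultimately show ?thesis using \<pp> by (auto simp: D_def zero_set_def)
    qed
    then have "(\<Union>i<length tss. ?St \<inter> D i) = ?St" by blast
    then show "(\<Union>i<length tss. dfb_locus n ts bs (tss ! i)) = ?St" using locus by simp
  qed
qed

end
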